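(* Let $\Omega\subset\mathbb{R}^n$ be open, let $\epsilon_0>0$, and let $f:\Omega\times[-\epsilon_0,\epsilon_0]\to\mathbb{R}^n$ be continuously differentiable with respect to $x$ and continuous in $\epsilon$. For $\epsilon\in[-\epsilon_0,\epsilon_0]$ consider the dynamical system $\Delta_\epsilon:\ \dot{x}=f(x(t),\epsilon)$ on $\Omega$. Suppose that the system $\Delta_\epsilon$ is dissipative uniformly with respect to $\epsilon$. Suppose that the unperturbed system $\Delta_0:\ \dot{x}=f(x(t),0)$ has an equilibrium point $x^*$ that is globally asymptotically stable in $\Omega$ and locally exponentially stable. Then there exists a positive constant $\epsilon^*\le\epsilon_0$, close enough to $0$, such that for every $\epsilon\in[-\epsilon^*,\epsilon^*]$ the system $\Delta_\epsilon$ has a unique equilibrium $x^*(\epsilon)$, and it is globally asymptotically stable in $\Omega$.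
   Context: For $x_0\in\Omega$, $t\mapsto x_\epsilon(x_0,t)$ denotes the unique maximal solution of $\Delta_\epsilon$ with $x_\epsilon(x_0,0)=x_0$. For $K\subset\Omega$, $x_\epsilon(K,t)=\{x_\epsilon(x_0,t):x_0\in K\}$. A set $K_0\subset\Omega$ is absorbing for $\Delta_\epsilon$ if for every bounded subset $K$ of $\Omega$ there is a finite time $t_0=t_0(K)$ such that $x_\epsilon(K,t)\subset K_0$ for all $t\ge t_0$. The system $\Delta_\epsilon$ is dissipative uniformly with respect to $\epsilon$ if there is a compact set $\mathcal{K}\subset\Omega$, independent of $\epsilon$, that is absorbing for $\Delta_\epsilon$ for every $\epsilon\in[-\epsilon_0,\epsilon_0]$. An equilibrium is globally asymptotically stable in $\Omega$ if it is Lyapunov stable and every solution starting in $\Omega$ converges to it as $t\to+\infty$. An equilibrium $x^*$ of $\Delta_0$ is locally exponentially stable if there are constants $C,\lambda,\delta>0$ such that the solution $y(t)$ of $\Delta_0$ with $y(0)=y_0$ satisfies $|y(t)-x^*|\le Ce^{-\lambda t}|y_0-x^*|$ for all $t\ge0$ and all $y_0\in\Omega$ with $|y_0-x^*|<\delta$. *)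

theory Defs
  imports "HOL-Analysis.Analysis"
begin

definition is_solution ::
    "('a::euclidean_space \<Rightarrow> 'a) \<Rightarrow> 'a set \<Rightarrow> 'a \<Rightarrow> real set \<Rightarrow> (real \<Rightarrow> 'a) \<Rightarrow> bool" where
  "is_solution g \<Omega> x\<^sub>0 T x \<longleftrightarrow>
     open T \<and> is_interval T \<and> 0 \<in> T \<and> x 0 = x\<^sub>0 \<and>
     (\<forall>t\<in>T. x t \<in> \<Omega> \<and> (x has_vector_derivative g (x t)) (at t))"

definition is_maximal_solution ::
    "('a::euclidean_space \<Rightarrow> 'a) \<Rightarrow> 'a set \<Rightarrow> 'a \<Rightarrow> real set \<Rightarrow> (real \<Rightarrow> 'a) \<Rightarrow> bool" where
  "is_maximal_solution g \<Omega> x\<^sub>0 T x \<longleftrightarrow>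
     is_solution g \<Omega> x\<^sub>0 T x \<and>
     (\<forall>T' x'. is_solution g \<Omega> x\<^sub>0 T' x' \<and> T \<subseteq> T' \<and> (\<forall>t\<in>T. x' t = x t) \<longrightarrow> T' = T)"

text \<open>
  The maximal solution with initial value \<open>x\<^sub>0\<close> is the partial function
  given by \<open>flow g \<Omega> x\<^sub>0\<close> on the domain \<open>existence_ivl g \<Omega> x\<^sub>0\<close>. Both descriptions are
  meaningful for \<open>x\<^sub>0 \<in> \<Omega>\<close> when \<open>\<Omega>\<close> is open and \<open>g\<close> is continuously differentiable on \<open>\<Omega>\<close>;
  \<open>flow\<close> is unspecified outside the domain, so every use below also requires
  \<open>t \<in> existence_ivl g \<Omega> x\<^sub>0\<close>.
\<close>

definition existence_ivl ::
    "('a::euclidean_space \<Rightarrow> 'a) \<Rightarrow> 'a set \<Rightarrow> 'a \<Rightarrow> real set" where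
  "existence_ivl g \<Omega> x\<^sub>0 = (THE T. \<exists>x. is_maximal_solution g \<Omega> x\<^sub>0 T x)"

definition flow ::
    "('a::euclidean_space \<Rightarrow> 'a) \<Rightarrow> 'a set \<Rightarrow> 'a \<Rightarrow> real \<Rightarrow> 'a" where
  "flow g \<Omega> x\<^sub>0 t = (THE y. \<exists>T x. is_maximal_solution g \<Omega> x\<^sub>0 T x \<and> t \<in> T \<and> y = x t)"

definition absorbing ::
    "('a::euclidean_space \<Rightarrow> 'a) \<Rightarrow> 'a set \<Rightarrow> 'a set \<Rightarrow> bool" where
  "absorbing g \<Omega> K\<^sub>0 \<longleftrightarrow>
     K\<^sub>0 \<subseteq> \<Omega> \<and>
     (\<forall>K. K \<subseteq> \<Omega> \<and> bounded K \<longrightarrow>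
        (\<exists>t\<^sub>0. \<forall>t\<ge>t\<^sub>0. (\<forall>x\<^sub>0\<in>K. t \<in> existence_ivl g \<Omega> x\<^sub>0) \<and>
                   (\<lambda>x\<^sub>0. flow g \<Omega> x\<^sub>0 t) ` K \<subseteq> K\<^sub>0))"

definition uniformly_dissipative ::
    "('a::euclidean_space \<Rightarrow> real \<Rightarrow> 'a) \<Rightarrow> 'a set \<Rightarrow> real \<Rightarrow> bool" where
  "uniformly_dissipative f \<Omega> \<epsilon>\<^sub>0 \<longleftrightarrow>
     (\<exists>\<K>. compact \<K> \<and> \<K> \<subseteq> \<Omega> \<and> (\<forall>\<epsilon>\<in>{-\<epsilon>\<^sub>0..\<epsilon>\<^sub>0}. absorbing (\<lambda>x. f x \<epsilon>) \<Omega> \<K>))"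

definition equilibrium ::
    "('a::euclidean_space \<Rightarrow> 'a) \<Rightarrow> 'a set \<Rightarrow> 'a \<Rightarrow> bool" where
  "equilibrium g \<Omega> p \<longleftrightarrow> p \<in> \<Omega> \<and> g p = 0"

definition lyapunov_stable ::
    "('a::euclidean_space \<Rightarrow> 'a) \<Rightarrow> 'a set \<Rightarrow> 'a \<Rightarrow> bool" where
  "lyapunov_stable g \<Omega> p \<longleftrightarrow>
     (\<forall>e>0. \<exists>d>0. \<forall>y\<^sub>0\<in>\<Omega>. norm (y\<^sub>0 - p) < d \<longrightarrow>
        (\<forall>t\<ge>0. t \<in> existence_ivl g \<Omega> y\<^sub>0 \<and> norm (flow g \<Omega> y\<^sub>0 t - p) < e))"

definition globally_asymptotically_stable ::
    "('a::euclidean_space \<Rightarrow> 'a) \<Rightarrow> 'a set \<Rightarrow> 'a \<Rightarrow> bool" where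
  "globally_asymptotically_stable g \<Omega> p \<longleftrightarrow>
     lyapunov_stable g \<Omega> p \<and>
     (\<forall>x\<^sub>0\<in>\<Omega>. {0..} \<subseteq> existence_ivl g \<Omega> x\<^sub>0 \<and> (flow g \<Omega> x\<^sub>0 \<longlongrightarrow> p) at_top)"

definition locally_exponentially_stable ::
    "('a::euclidean_space \<Rightarrow> 'a) \<Rightarrow> 'a set \<Rightarrow> 'a \<Rightarrow> bool" where
  "locally_exponentially_stable g \<Omega> p \<longleftrightarrow>
     (\<exists>C>0. \<exists>l>0. \<exists>\<delta>>0. \<forall>y\<^sub>0\<in>\<Omega>. norm (y\<^sub>0 - p) < \<delta> \<longrightarrow>
        (\<forall>t\<ge>0. t \<in> existence_ivl g \<Omega> y\<^sub>0 \<and>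
               norm (flow g \<Omega> y\<^sub>0 t - p) \<le> C * exp (- l * t) * norm (y\<^sub>0 - p)))"

text \<open>
  Continuous differentiability in \<open>x\<close> means that the partial derivative \<open>D\<^sub>x f\<close> is continuous
  jointly in \<open>(x, \<epsilon>)\<close>. Continuity of \<open>D\<^sub>x f(\<cdot>, \<epsilon>)\<close> for each fixed \<open>\<epsilon>\<close> would not be enough, even
  for jointly continuous \<open>f\<close>: \<open>-x + \<epsilon> sin (x/\<epsilon>\<^sup>2)\<close> has several zeros for all small \<open>\<epsilon> > 0\<close>.
  Joint continuity of \<open>f\<close> follows from the two conditions below.
\<close>

definition C1_in_state ::
    "('a::euclidean_space \<Rightarrow> real \<Rightarrow> 'a) \<Rightarrow> 'a set \<Rightarrow> real \<Rightarrow> bool" where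
  "C1_in_state f \<Omega> \<epsilon>\<^sub>0 \<longleftrightarrow>
     (\<exists>Df :: 'a \<Rightarrow> real \<Rightarrow> 'a \<Rightarrow>\<^sub>L 'a.
        (\<forall>\<epsilon>\<in>{-\<epsilon>\<^sub>0..\<epsilon>\<^sub>0}. \<forall>x\<in>\<Omega>. ((\<lambda>y. f y \<epsilon>) has_derivative blinfun_apply (Df x \<epsilon>)) (at x)) \<and>
        continuous_on (\<Omega> \<times> {-\<epsilon>\<^sub>0..\<epsilon>\<^sub>0}) (\<lambda>(x, \<epsilon>). Df x \<epsilon>))"

definition continuous_in_parameter ::
    "('a::euclidean_space \<Rightarrow> real \<Rightarrow> 'a) \<Rightarrow> 'a set \<Rightarrow> real \<Rightarrow> bool" where
  "continuous_in_parameter f \<Omega> \<epsilon>\<^sub>0 \<longleftrightarrow> (\<forall>x\<in>\<Omega>. continuous_on {-\<epsilon>\<^sub>0..\<epsilon>\<^sub>0} (f x))"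

end

theory Submission
  imports Defs
begin

text \<open>
  Near \<open>x\<^sub>s\<close> the perturbed systems are contractions, and far from \<open>x\<^sub>s\<close> they follow the unperturbed
  system for long enough to get near \<open>x\<^sub>s\<close>.

  Locally, let \<open>A\<close> be the derivative of \<open>f(\<cdot>, 0)\<close> at \<open>x\<^sub>s\<close>. Exponential stability says that after some
  time \<open>T\<close> the unperturbed flow reduces small distances to \<open>x\<^sub>s\<close> to a quarter. Every curve that almost
  solves \<open>w' = A w\<close> stays close to a magnified unperturbed solution and hence is halved after time \<open>T\<close>
  (\<open>exponential_stability_contracts\<close>). For small parameters \<open>\<epsilon>\<close>, the difference of two solutions of
  the perturbed system near \<open>x\<^sub>s\<close> is such a curve, and so is the distance vector from a solution to \<open>x\<^sub>s\<close>,
  up to the small error \<open>f(x\<^sub>s, \<epsilon>)\<close>. Consequently a ball around \<open>x\<^sub>s\<close> traps solutions, any two trapped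
  solutions approach each other exponentially, and, comparing a trapped solution with its own time
  shifts, each of them converges to an equilibrium, which is the same for all of them
  (locale \<open>trapping_ball\<close>).

  Globally, every solution of a perturbed system reaches the compact absorbing set \<open>\<K>\<close>, which is
  independent of \<open>\<epsilon>\<close>. Unperturbed solutions starting in \<open>\<K>\<close> enter the trapping ball; by continuous dependence
  on initial value and parameter, and by compactness of \<open>\<K>\<close>, so do the perturbed ones for all
  sufficiently small \<open>\<epsilon>\<close> (\<open>uniform_entry\<close>).

  The theory of initial value problems that is used here is derived from one Gronwall estimate
  (\<open>gronwall_bootstrap\<close>) and Picard's theorem (\<open>local_solution_exists\<close>).
\<close>

section \<open>Gronwall's inequality and Lipschitz tubes\<close>

text \<open>
  Gronwall's inequality with a bootstrap: the differential inequality is only needed while the curve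
  stays in the ball of radius \<open>\<rho>\<close>, because the resulting bound itself keeps the curve there. This is what
  allows local Lipschitz and linearisation estimates to be used without knowing beforehand that
  solutions stay where these estimates hold.
\<close>
lemma gronwall_bootstrap:
  fixes w :: "real \<Rightarrow> 'a::real_normed_vector"
  assumes w: "\<And>t. t \<in> {0..T} \<Longrightarrow> (w has_vector_derivative w' t) (at t)"
    and L: "0 \<le> L" and k: "0 \<le> \<kappa>"
    and bound: "\<And>t. t \<in> {0..T} \<Longrightarrow> norm (w t) \<le> \<rho> \<Longrightarrow> norm (w' t) \<le> L * norm (w t) + \<kappa>"
    and small: "(norm (w 0) + \<kappa> * T) * exp (L * T) < \<rho>"
    and t: "t \<in> {0..T}"
  shows "norm (w t) \<le> (norm (w 0) + \<kappa> * t) * exp (L * t)"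
proof -
  have contw: "continuous_on {0..T} w"
    by (meson continuous_at_imp_continuous_on has_vector_derivative_continuous w)
  have strict: "norm (w t) < (a + \<kappa> * t) * exp (L * t)"
    if a: "norm (w 0) < a" "(a + \<kappa> * T) * exp (L * T) \<le> \<rho>" and t: "t \<in> {0..T}" for a t
  proof (rule ccontr)
    define u where "u = (\<lambda>s. (a + \<kappa> * s) * exp (L * s))"
    define S where "S = {s \<in> {0..T}. u s \<le> norm (w s)}"
    have contu: "continuous_on X u" for X unfolding u_def by (intro continuous_intros)
    assume "\<not> norm (w t) < (a + \<kappa> * t) * exp (L * t)"
    then have "t \<in> S" using t by (auto simp: S_def u_def)
    have "closed S" unfolding S_def
      by (rule continuous_on_closed_Collect_le[OF contu continuous_on_norm[OF contw]]) simp
    moreover have "bounded S"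
      by (rule bounded_subset[of "{0..T}"]) (auto simp: S_def)
    ultimately have "compact S" by (simp add: compact_eq_bounded_closed)
    \<comment> \<open>At the first time \<open>s\<close> where the norm reaches the comparison function \<open>u\<close>, the derivative bound has
      held all along, so the mean value inequality contradicts the gap between the two at time \<open>0\<close>.\<close>
    then obtain s where s: "s \<in> S" "\<And>r. r \<in> S \<Longrightarrow> s \<le> r"
      using compact_attains_inf[of S] \<open>t \<in> S\<close> by blast
    have before: "norm (w r) < u r" if "0 \<le> r" "r < s" for r
      using s that by (force simp: S_def)
    have s': "0 \<le> s" "s \<le> T" "u s \<le> norm (w s)" using s(1) by (simp_all add: S_def)
    moreover have "norm (w 0) < u 0" using a by (simp add: u_def)
    ultimately have s0: "0 < s" "s \<le> T" by (cases "s = 0"; simp)+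
    have umono: "u r \<le> \<rho>" if "0 \<le> r" "r \<le> s" for r
    proof -
      have "\<kappa> * r \<le> \<kappa> * T" "L * r \<le> L * T"
        using that s0 k L by (auto intro: mult_left_mono)
      moreover have "0 \<le> a" using a norm_ge_zero[of "w 0"] by linarith
      moreover have "0 \<le> \<kappa> * r" using that k by simp
      ultimately have "u r \<le> (a + \<kappa> * T) * exp (L * T)" unfolding u_def
        by (intro mult_mono) auto
      then show ?thesis using a by simp
    qed
    have "norm (w s - w 0) \<le> u s - u 0"
    proof (rule differentiable_bound_general[of 0 s w u w' "\<lambda>r. L * u r + \<kappa> * exp (L * r)"])
      show "continuous_on {0..s} w" using contw s0 by (auto intro: continuous_on_subset)
      show "continuous_on {0..s} u" by (rule contu)
      fix r assume r: "0 < r" "r < s"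
      show "(w has_vector_derivative w' r) (at r)" using w r s0 by auto
      show "(u has_vector_derivative L * u r + \<kappa> * exp (L * r)) (at r)"
        unfolding u_def has_real_derivative_iff_has_vector_derivative[symmetric]
        by (auto intro!: derivative_eq_intros simp: algebra_simps)
      have "norm (w' r) \<le> L * norm (w r) + \<kappa>"
        using r s0 before[of r] umono[of r] by (intro bound) auto
      also have "\<dots> \<le> L * u r + \<kappa> * exp (L * r)"
      proof (intro add_mono mult_left_mono L)
        show "norm (w r) \<le> u r" using before[of r] r by simp
        show "\<kappa> \<le> \<kappa> * exp (L * r)"
          using mult_left_mono[of 1 "exp (L * r)" \<kappa>] k L r by simp
      qed
      finally show "norm (w' r) \<le> L * u r + \<kappa> * exp (L * r)" .
    qed (use s0 in auto)
    moreover have "u s \<le> norm (w s)" by (rule s')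
    moreover have "norm (w s) \<le> norm (w s - w 0) + norm (w 0)"
      by (metis diff_add_cancel norm_triangle_ineq)
    ultimately show False using a by (simp add: u_def)
  qed
  have scale: "p * exp q < b \<longleftrightarrow> p < b * exp (- q)" "b < p * exp q \<longleftrightarrow> b * exp (- q) < p"
    "p * exp q \<le> b \<longleftrightarrow> p \<le> b * exp (- q)" "b \<le> p * exp q \<longleftrightarrow> b * exp (- q) \<le> p"
    for p q b :: real
    by (simp_all add: exp_minus divide_simps flip: divide_inverse)
  have "norm (w t) * exp (- (L * t)) - \<kappa> * t \<le> norm (w 0)"
  proof (rule dense_ge_bounded[of "norm (w 0)" "\<rho> * exp (- (L * T)) - \<kappa> * T"])
    show "norm (w 0) < \<rho> * exp (- (L * T)) - \<kappa> * T"
      using scale(1)[THEN iffD1, OF small] by linarith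
    fix a assume a: "norm (w 0) < a" "a < \<rho> * exp (- (L * T)) - \<kappa> * T"
    then have "(a + \<kappa> * T) * exp (L * T) \<le> \<rho>" by (intro scale(3)[THEN iffD2]) linarith
    then have "norm (w t) < (a + \<kappa> * t) * exp (L * t)"
      using a t by (intro strict) auto
    from scale(2)[THEN iffD1, OF this]
    show "norm (w t) * exp (- (L * t)) - \<kappa> * t \<le> a" by linarith
  qed
  then show ?thesis by (intro scale(4)[THEN iffD2]) linarith
qed

text \<open>
  The closed \<open>\<rho>\<close>-neighbourhood of \<open>K\<close> is again a compact subset of \<open>\<Omega>\<close>, and on compact sets local
  Lipschitz continuity is global. Applied to the trajectory \<open>K\<close> of a solution, it supplies the
  hypotheses of \<open>gronwall_bootstrap\<close> for nearby solutions.
\<close>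
lemma uniform_tube:
  fixes F :: "real \<Rightarrow> 'a::euclidean_space \<Rightarrow> 'a"
  assumes lip: "local_lipschitz I \<Omega> F" and "compact I"
    and cont: "\<And>x. x \<in> \<Omega> \<Longrightarrow> continuous_on I (\<lambda>e. F e x)"
    and "open \<Omega>" and "compact K" and "K \<subseteq> \<Omega>"
  obtains \<rho> L where "\<rho> > 0" "L \<ge> 0"
    "\<And>x w. x \<in> K \<Longrightarrow> norm w \<le> \<rho> \<Longrightarrow> x + w \<in> \<Omega>"
    "\<And>e x w. e \<in> I \<Longrightarrow> x \<in> K \<Longrightarrow> norm w \<le> \<rho> \<Longrightarrow> norm (F e (x + w) - F e x) \<le> L * norm w"
proof -
  obtain \<rho> where r: "\<rho> > 0" "(\<Union>x\<in>K. cball x \<rho>) \<subseteq> \<Omega>"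
    using compact_subset_open_imp_cball_epsilon_subset[OF \<open>compact K\<close> \<open>open \<Omega>\<close> \<open>K \<subseteq> \<Omega>\<close>] by blast
  define X where "X = {x + w |x w. x \<in> K \<and> w \<in> cball 0 \<rho>}"
  have X: "X \<subseteq> \<Omega>"
  proof
    fix z assume "z \<in> X"
    then obtain x w where "z = x + w" "x \<in> K" "norm w \<le> \<rho>" by (auto simp: X_def)
    then have "z \<in> cball x \<rho>" by (simp add: dist_norm)
    then show "z \<in> \<Omega>" using r \<open>x \<in> K\<close> by blast
  qed
  have "compact X" unfolding X_def
    using compact_sums[OF \<open>compact K\<close> compact_cball[of 0 \<rho>]] by simp
  have "local_lipschitz I X F"
    by (rule local_lipschitz_subset[OF lip]) (use X in auto)
  then obtain L where L: "\<And>e. e \<in> I \<Longrightarrow> L-lipschitz_on X (F e)"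
    using local_lipschitz_compact_implies_lipschitz[of I X F] \<open>compact X\<close> \<open>compact I\<close> cont X
    by blast
  show thesis
  proof
    show "\<rho> > 0" "max L 0 \<ge> 0" using r by auto
    fix x w :: 'a assume xw: "x \<in> K" "norm w \<le> \<rho>"
    then have "x + w \<in> X" by (auto simp: X_def)
    then show "x + w \<in> \<Omega>" using X by auto
    have "x + 0 \<in> X" using xw r unfolding X_def by (intro CollectI exI[of _ x] exI[of _ 0]) auto
    fix e assume "e \<in> I"
    have "norm (F e (x + w) - F e x) \<le> L * norm w"
      using lipschitz_onD[OF L[OF \<open>e \<in> I\<close>] \<open>x + w \<in> X\<close> \<open>x + 0 \<in> X\<close>] by (simp add: dist_norm)
    then show "norm (F e (x + w) - F e x) \<le> max L 0 * norm w"
      by (smt (verit, best) mult_right_mono norm_ge_zero)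
  qed
qed

section \<open>Existence and uniqueness of the flow\<close>

text \<open>
  Picard's theorem, by Banach's fixed point theorem for the integral operator.
\<close>
lemma local_solution_exists:
  fixes g :: "'a::euclidean_space \<Rightarrow> 'a"
  assumes "open \<Omega>" and lip: "local_lipschitz {0::real} \<Omega> (\<lambda>_. g)" and "x\<^sub>0 \<in> \<Omega>"
  obtains T x where "is_solution g \<Omega> x\<^sub>0 T x"
proof -
  obtain u L where "u > 0"
    and L: "\<And>s. s \<in> cball 0 u \<inter> {0} \<Longrightarrow> L-lipschitz_on (cball x\<^sub>0 u \<inter> \<Omega>) g"
    using local_lipschitzE[OF lip, of 0 x\<^sub>0] \<open>x\<^sub>0 \<in> \<Omega>\<close> by auto
  obtain r0 where "r0 > 0" "cball x\<^sub>0 r0 \<subseteq> \<Omega>"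
    using \<open>open \<Omega>\<close> \<open>x\<^sub>0 \<in> \<Omega>\<close> open_contains_cball by blast
  define r where "r = min u r0"
  have r: "r > 0" "cball x\<^sub>0 r \<subseteq> cball x\<^sub>0 u \<inter> \<Omega>"
    using \<open>u > 0\<close> \<open>r0 > 0\<close> \<open>cball x\<^sub>0 r0 \<subseteq> \<Omega>\<close> by (auto simp: r_def)
  have lipg: "L-lipschitz_on (cball x\<^sub>0 r) g"
    using L[of 0] \<open>u > 0\<close> r by (auto intro: lipschitz_on_subset)
  then have "L \<ge> 0" by (rule lipschitz_on_nonneg)
  have contg: "continuous_on (cball x\<^sub>0 r) g" by (rule lipschitz_on_continuous_on[OF lipg])
  then have "bounded (g ` cball x\<^sub>0 r)"
    by (intro compact_imp_bounded compact_continuous_image compact_cball)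
  then obtain B where "B > 0" and B: "\<And>y. y \<in> cball x\<^sub>0 r \<Longrightarrow> norm (g y) \<le> B"
    by (auto simp: bounded_pos)
  \<comment> \<open>The integrals over \<open>[-h, t]\<close> and \<open>[-h, 0]\<close> have total length at most \<open>3 * h\<close>: the two terms of the
    minimum keep the iterates in the ball and give contraction by one half.\<close>
  define h where "h = min (r / (3 * B)) (1 / (6 * (L + 1)))"
  have h: "h > 0" "3 * h * B \<le> r" "3 * h * L \<le> 1 / 2"
  proof -
    show "h > 0" using \<open>r > 0\<close> \<open>B > 0\<close> \<open>L \<ge> 0\<close> by (simp add: h_def)
    have "h \<le> r / (3 * B)" by (simp add: h_def)
    then show "3 * h * B \<le> r" using \<open>B > 0\<close> by (simp add: field_simps)
    have "h \<le> 1 / (6 * (L + 1))" by (simp add: h_def)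
    then have "h * (6 * (L + 1)) \<le> 1" using \<open>L \<ge> 0\<close> by (simp add: field_simps)
    then show "3 * h * L \<le> 1 / 2" using \<open>h > 0\<close> by (simp add: algebra_simps)
  qed
  \<comment> \<open>Clamping time to \<open>[-h, h]\<close> makes the Picard operator act on bounded continuous functions on the
    whole line, a complete metric space.\<close>
  define c where "c = (\<lambda>t. max (- h) (min h t))"
  have c: "c t \<in> {-h..h}" for t using h by (auto simp: c_def)
  define S where "S = PiC UNIV (\<lambda>_::real. cball x\<^sub>0 r)"
  \<comment> \<open>Integrating from \<open>-h\<close> and subtracting the value at \<open>0\<close> treats both time directions at once.\<close>
  define J where "J = (\<lambda>(y::real \<Rightarrow>\<^sub>C 'a) t. integral {-h..t} (\<lambda>s. g (y s)))"
  define Q where "Q = (\<lambda>y t. x\<^sub>0 + J y (c t) - J y 0)"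
  have contgy: "continuous_on X (\<lambda>s. g (y s))" if "y \<in> S" for X and y :: "real \<Rightarrow>\<^sub>C 'a"
    using that by (intro continuous_on_compose2[OF contg])
      (auto simp: S_def mem_PiC_iff)
  have Jder: "(J y has_vector_derivative g (y t)) (at t within {-h..h})"
    if "y \<in> S" "t \<in> {-h..h}" for y t
    unfolding J_def using integral_has_vector_derivative[OF contgy[OF that(1)] that(2)] by simp
  have Jcont: "continuous_on {-h..h} (J y)" if "y \<in> S" for y
    using Jder[OF that] has_vector_derivative_continuous continuous_on_eq_continuous_within by blast
  have Jbound: "norm (J y t - J y 0) \<le> 3 * h * B" if "y \<in> S" "t \<in> {-h..h}" for y t
  proof -
    have "norm (J y t) \<le> B * (t - - h)" if "t \<in> {-h..h}" for t unfolding J_def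
      using that \<open>y \<in> S\<close> by (intro integral_bound contgy B) (auto simp: S_def mem_PiC_iff)
    from this[of t] this[of 0] have "norm (J y t) \<le> B * (t + h)" "norm (J y 0) \<le> B * h"
      using that h by auto
    moreover have "B * (t + h) \<le> B * (2 * h)" using that \<open>B > 0\<close> by (intro mult_left_mono) auto
    ultimately show ?thesis
      using norm_triangle_ineq4[of "J y t" "J y 0"] by (simp add: algebra_simps)
  qed
  have Qcont: "continuous_on UNIV (Q y)" if "y \<in> S" for y
    unfolding Q_def using c
    by (intro continuous_intros continuous_on_compose2[OF Jcont[OF that]]) (auto simp: c_def intro!: continuous_intros)
  have Qball: "Q y t \<in> cball x\<^sub>0 r" if "y \<in> S" for y t
    using Jbound[OF that c[of t]] h by (simp add: Q_def dist_norm norm_minus_commute algebra_simps)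
  have QB: "Q y \<in> bcontfun" if "y \<in> S" for y
    unfolding bcontfun_def using Qcont[OF that] Qball[OF that]
    by (auto intro!: bounded_subset[OF bounded_cball[of x\<^sub>0 r]])
  define P where "P = (\<lambda>y. Bcontfun (Q y))"
  have P: "apply_bcontfun (P y) = Q y" if "y \<in> S" for y
    unfolding P_def using QB[OF that] by (simp add: Bcontfun_inverse)
  have "\<exists>!y\<in>S. P y = y"
  proof (rule Banach_fix)
    have "closed S" unfolding S_def by (intro closed_PiC) auto
    then show "complete S" by (simp add: complete_eq_closed)
    have "const_bcontfun x\<^sub>0 \<in> S" unfolding S_def mem_PiC_iff
      using r by (auto simp: const_bcontfun.rep_eq)
    then show "S \<noteq> {}" by auto
    show "P ` S \<subseteq> S" using P Qball by (auto simp: S_def mem_PiC_iff)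
    show "(0::real) \<le> 1/2" "(1/2::real) < 1" by auto
    fix y z assume yz: "y \<in> S" "z \<in> S"
    show "dist (P y) (P z) \<le> 1 / 2 * dist y z"
    proof (rule dist_bound)
      fix t
      have d: "norm (J y s - J z s) \<le> L * dist y z * (s + h)" if "s \<in> {-h..h}" for s
      proof -
        have "J y s - J z s = integral {-h..s} (\<lambda>s. g (y s) - g (z s))" unfolding J_def
          by (intro Henstock_Kurzweil_Integration.integral_diff[symmetric] integrable_continuous_real contgy yz)
        moreover have "norm (integral {-h..s} (\<lambda>s. g (y s) - g (z s))) \<le> (L * dist y z) * (s - - h)"
        proof (intro integral_bound continuous_intros contgy yz)
          fix t
          have "dist (g (y t)) (g (z t)) \<le> L * dist (y t) (z t)"
            using yz by (intro lipschitz_onD[OF lipg]) (auto simp: S_def mem_PiC_iff)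
          also have "\<dots> \<le> L * dist y z" by (intro mult_left_mono dist_bounded \<open>L \<ge> 0\<close>)
          finally show "norm (g (y t) - g (z t)) \<le> L * dist y z" by (simp add: dist_norm)
        qed (use that in auto)
        ultimately show ?thesis by simp
      qed
      have dc: "norm (J y (c t) - J z (c t)) \<le> L * dist y z * (2 * h)"
      proof -
        have "L * dist y z * (c t + h) \<le> L * dist y z * (2 * h)"
          using c[of t] \<open>L \<ge> 0\<close> by (intro mult_left_mono) auto
        then show ?thesis using d[OF c[of t]] by linarith
      qed
      have d0: "norm (J y 0 - J z 0) \<le> L * dist y z * h" using d[of 0] h by simp
      have "dist (P y t) (P z t) = norm ((J y (c t) - J z (c t)) - (J y 0 - J z 0))"
        using yz by (simp add: P Q_def dist_norm algebra_simps)
      also have "\<dots> \<le> L * dist y z * (2 * h) + L * dist y z * h"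
        using dc d0 norm_triangle_ineq4[of "J y (c t) - J z (c t)" "J y 0 - J z 0"] by linarith
      also have "\<dots> = (3 * h * L) * dist y z" by (simp add: algebra_simps)
      also have "\<dots> \<le> 1 / 2 * dist y z" using h by (intro mult_right_mono) auto
      finally show "dist (P y t) (P z t) \<le> 1 / 2 * dist y z" .
    qed
  qed
  then obtain y where y: "y \<in> S" "P y = y" by blast
  have yt: "y t = x\<^sub>0 + J y t - J y 0" if "t \<in> {-h..h}" for t
    using P[OF y(1)] y(2) that by (auto simp: Q_def c_def)
  have "is_solution g \<Omega> x\<^sub>0 {-h<..<h} (apply_bcontfun y)"
    unfolding is_solution_def
  proof (intro conjI ballI)
    show "y 0 = x\<^sub>0" using yt[of 0] h by simp
    fix t assume t: "t \<in> {-h<..<h}"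
    show "y t \<in> \<Omega>" using y r by (auto simp: S_def mem_PiC_iff)
    have "((\<lambda>t. x\<^sub>0 + J y t - J y 0) has_vector_derivative g (y t)) (at t within {-h..h})"
      using t by (auto intro!: derivative_eq_intros Jder y)
    then have "(apply_bcontfun y has_vector_derivative g (y t)) (at t within {-h..h})"
      using t by (elim has_vector_derivative_transform[rotated 2]) (auto simp: yt)
    moreover have "at t within {-h..h} = at t"
      using t by (simp add: at_within_Icc_at)
    ultimately show "(apply_bcontfun y has_vector_derivative g (y t)) (at t)" by simp
  qed (use h in \<open>auto simp: is_interval_1\<close>)
  then show thesis by (rule that)
qed

lemma solutions_agree_forward:
  fixes g :: "'a::euclidean_space \<Rightarrow> 'a"
  assumes "open \<Omega>" and lip: "local_lipschitz {0::real} \<Omega> (\<lambda>_. g)"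
    and x: "\<And>t. t \<in> {0..T} \<Longrightarrow> x t \<in> \<Omega> \<and> (x has_vector_derivative g (x t)) (at t)"
    and y: "\<And>t. t \<in> {0..T} \<Longrightarrow> (y has_vector_derivative g (y t)) (at t)"
    and "x 0 = y 0" and "0 \<le> T"
  shows "x T = y T"
proof -
  have "continuous_on {0..T} x"
    by (meson continuous_at_imp_continuous_on has_vector_derivative_continuous x)
  then have "compact (x ` {0..T})" by (rule compact_continuous_image) simp
  moreover have "x ` {0..T} \<subseteq> \<Omega>" using x by auto
  ultimately obtain \<rho> L where tube: "\<rho> > 0" "L \<ge> 0"
    "\<And>e z w. e \<in> {0::real} \<Longrightarrow> z \<in> x ` {0..T} \<Longrightarrow> norm w \<le> \<rho> \<Longrightarrow> norm (g (z + w) - g z) \<le> L * norm w"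
    using uniform_tube[OF lip _ continuous_on_sing \<open>open \<Omega>\<close>, of "x ` {0..T}"]
    by (metis finite.emptyI finite.insertI finite_imp_compact)
  have "norm (y T - x T) \<le> (norm (y 0 - x 0) + 0 * T) * exp (L * T)"
  proof (rule gronwall_bootstrap[where w = "\<lambda>t. y t - x t" and w' = "\<lambda>t. g (y t) - g (x t)" and T = T and \<rho> = \<rho>])
    fix t assume t: "t \<in> {0..T}"
    show "((\<lambda>t. y t - x t) has_vector_derivative g (y t) - g (x t)) (at t)"
      using x[OF t] y[OF t] by (auto intro: has_vector_derivative_diff)
    show "norm (g (y t) - g (x t)) \<le> L * norm (y t - x t) + 0" if "norm (y t - x t) \<le> \<rho>"
      using tube(3)[of 0 "x t" "y t - x t"] that t by simp
  qed (use tube assms in auto)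
  then show ?thesis using assms by simp
qed

text \<open>
  Forwards in time this is Gronwall's inequality with zero initial distance; the past of a solution is
  the future of a solution for \<open>-g\<close>.
\<close>
lemma solutions_unique:
  fixes g :: "'a::euclidean_space \<Rightarrow> 'a"
  assumes "open \<Omega>" and lip: "local_lipschitz {0::real} \<Omega> (\<lambda>_. g)"
    and x: "is_solution g \<Omega> x\<^sub>0 T x" and y: "is_solution g \<Omega> x\<^sub>0 T' y"
    and t: "t \<in> T" "t \<in> T'"
  shows "x t = y t"
proof -
  have seg: "s \<in> T \<and> s \<in> T'" if "min 0 t \<le> s" "s \<le> max 0 t" for s
  proof (cases "t \<ge> 0")
    case True
    then have "0 \<le> s" "s \<le> t" using that by auto
    then show ?thesis using x y t unfolding is_solution_def is_interval_1 by blast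
  next
    case False
    then have "t \<le> s" "s \<le> 0" using that by auto
    then show ?thesis using x y t unfolding is_solution_def is_interval_1 by blast
  qed
  have xs: "x s \<in> \<Omega>" "(x has_vector_derivative g (x s)) (at s)" and
    ys: "(y has_vector_derivative g (y s)) (at s)" if "min 0 t \<le> s" "s \<le> max 0 t" for s
    using x y seg[OF that] by (auto simp: is_solution_def)
  have init: "x 0 = y 0" using x y by (simp add: is_solution_def)
  show ?thesis
  proof (cases "t \<ge> 0")
    case True
    show ?thesis
      by (rule solutions_agree_forward[of \<Omega> g t x y])
        (use \<open>open \<Omega>\<close> lip xs ys init True in auto)
  next
    case False
    have lip': "local_lipschitz {0::real} \<Omega> (\<lambda>_ z. - g z)"
      using lip by (simp add: local_lipschitz_minus)
    have rev: "((\<lambda>s. z (- s)) has_vector_derivative - g (z (- s))) (at s)"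
      if "(z has_vector_derivative g (z (- s))) (at (- s))" for z :: "real \<Rightarrow> 'a" and s
    proof -
      have "(z \<circ> uminus has_vector_derivative (- 1) *\<^sub>R g (z (- s))) (at s)"
        using that by (intro vector_diff_chain_at) (auto intro!: derivative_eq_intros)
      then show ?thesis by (simp add: o_def)
    qed
    have "x (- (- t)) = y (- (- t))"
    proof (rule solutions_agree_forward[of \<Omega> "\<lambda>z. - g z" "- t" "\<lambda>s. x (- s)" "\<lambda>s. y (- s)"])
      fix s assume s: "s \<in> {0..- t}"
      show "x (- s) \<in> \<Omega> \<and> ((\<lambda>s. x (- s)) has_vector_derivative - g (x (- s))) (at s)"
        using xs[of "- s"] rev[of x s] s by auto
      show "((\<lambda>s. y (- s)) has_vector_derivative - g (y (- s))) (at s)"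
        using ys[of "- s"] rev[of y s] s by auto
    qed (use \<open>open \<Omega>\<close> lip' init False in auto)
    then show ?thesis by simp
  qed
qed

text \<open>
  This turns the two definite descriptions behind the flow into usable facts.
\<close>
lemma flow_is_solution:
  fixes g :: "'a::euclidean_space \<Rightarrow> 'a"
  assumes "open \<Omega>" and lip: "local_lipschitz {0::real} \<Omega> (\<lambda>_. g)" and "x\<^sub>0 \<in> \<Omega>"
  shows "is_solution g \<Omega> x\<^sub>0 (existence_ivl g \<Omega> x\<^sub>0) (flow g \<Omega> x\<^sub>0)"
proof -
  \<comment> \<open>The maximal solution is the union of all solutions; uniqueness makes the union well defined.\<close>
  define U where "U = \<Union>{T. \<exists>x. is_solution g \<Omega> x\<^sub>0 T x}"
  define X where "X = (\<lambda>t. SOME y. \<exists>T x. is_solution g \<Omega> x\<^sub>0 T x \<and> t \<in> T \<and> y = x t)"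
  have X: "X t = x t" if "is_solution g \<Omega> x\<^sub>0 T x" "t \<in> T" for t T x
  proof -
    have "\<exists>T x'. is_solution g \<Omega> x\<^sub>0 T x' \<and> t \<in> T \<and> X t = x' t"
      unfolding X_def by (rule someI_ex) (use that in blast)
    then show ?thesis using solutions_unique[OF \<open>open \<Omega>\<close> lip] that by metis
  qed
  obtain T1 x1 where ex: "is_solution g \<Omega> x\<^sub>0 T1 x1"
    using local_solution_exists[OF assms] by blast
  have sol: "is_solution g \<Omega> x\<^sub>0 U X"
    unfolding is_solution_def
  proof (intro conjI ballI)
    show "open U" by (auto simp: U_def is_solution_def)
    have "connected U" unfolding U_def
      by (rule connected_Union) (auto simp: is_solution_def is_interval_connected_1)
    then show "is_interval U" by (simp add: is_interval_connected_1)
    show "0 \<in> U" using ex by (auto simp: U_def is_solution_def)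
    show "X 0 = x\<^sub>0" using X[OF ex, of 0] ex by (auto simp: is_solution_def)
    fix t assume "t \<in> U"
    then obtain T x where T: "is_solution g \<Omega> x\<^sub>0 T x" "t \<in> T" by (auto simp: U_def)
    then show "X t \<in> \<Omega>" using X[OF T] by (auto simp: is_solution_def)
    have "(x has_vector_derivative g (x t)) (at t)" "open T"
      using T by (auto simp: is_solution_def)
    then have "(X has_vector_derivative g (x t)) (at t)"
      using T X by (elim has_vector_derivative_transform_within_open) auto
    then show "(X has_vector_derivative g (X t)) (at t)" using X[OF T] by simp
  qed
  have sub: "T \<subseteq> U" if "is_solution g \<Omega> x\<^sub>0 T x" for T x using that by (auto simp: U_def)
  have max: "is_maximal_solution g \<Omega> x\<^sub>0 U X"
    unfolding is_maximal_solution_def using sol sub by blast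
  have maxU: "T = U" if "is_maximal_solution g \<Omega> x\<^sub>0 T x" for T x
    using that sol sub X unfolding is_maximal_solution_def by blast
  have U: "existence_ivl g \<Omega> x\<^sub>0 = U"
    unfolding existence_ivl_def by (rule the_equality) (use max maxU in blast)+
  have flow: "flow g \<Omega> x\<^sub>0 t = X t" if "t \<in> U" for t
    unfolding flow_def
  proof (rule the_equality)
    show "\<exists>T x. is_maximal_solution g \<Omega> x\<^sub>0 T x \<and> t \<in> T \<and> X t = x t" using max that by blast
    fix y assume "\<exists>T x. is_maximal_solution g \<Omega> x\<^sub>0 T x \<and> t \<in> T \<and> y = x t"
    then show "y = X t" using X by (auto simp: is_maximal_solution_def)
  qed
  show ?thesis unfolding U is_solution_def
  proof (intro conjI ballI)
    fix t assume t: "t \<in> U"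
    have "(X has_vector_derivative g (X t)) (at t)" "open U"
      using sol t by (auto simp: is_solution_def)
    then have "(flow g \<Omega> x\<^sub>0 has_vector_derivative g (X t)) (at t)"
      using t flow by (elim has_vector_derivative_transform_within_open) auto
    then show "(flow g \<Omega> x\<^sub>0 has_vector_derivative g (flow g \<Omega> x\<^sub>0 t)) (at t)"
      using flow[OF t] by simp
  qed (use sol flow in \<open>auto simp: is_solution_def\<close>)
qed

text \<open>
  Solutions with two-sided derivatives, also at time \<open>0\<close>: they arise from restricting solutions on
  open intervals, and with two-sided derivatives no one-sided limits need to be treated.
\<close>
definition forward_solution :: "('a::euclidean_space \<Rightarrow> 'a) \<Rightarrow> 'a set \<Rightarrow> (real \<Rightarrow> 'a) \<Rightarrow> bool" where
  "forward_solution g \<Omega> x \<longleftrightarrow> (\<forall>t\<ge>0. x t \<in> \<Omega> \<and> (x has_vector_derivative g (x t)) (at t))"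

lemma forward_solution_shift:
  assumes "forward_solution g \<Omega> x" and "s \<ge> 0"
  shows "forward_solution g \<Omega> (\<lambda>t. x (s + t))"
  unfolding forward_solution_def
proof (intro allI impI conjI)
  fix t :: real assume "t \<ge> 0"
  with assms have x: "x (s + t) \<in> \<Omega>" "(x has_vector_derivative g (x (s + t))) (at (s + t))"
    by (auto simp: forward_solution_def)
  then show "x (s + t) \<in> \<Omega>" by simp
  have "(x \<circ> (\<lambda>t. s + t) has_vector_derivative 1 *\<^sub>R g (x (s + t))) (at t)"
    using x by (intro vector_diff_chain_at) (auto intro!: derivative_eq_intros)
  then show "((\<lambda>t. x (s + t)) has_vector_derivative g (x (s + t))) (at t)" by (simp add: o_def)
qed

lemma limit_is_equilibrium:
  fixes g :: "'a::euclidean_space \<Rightarrow> 'a"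
  assumes x: "forward_solution g \<Omega> x" and lim: "(x \<longlongrightarrow> l) at_top" and cont: "isCont g l"
  shows "g l = 0"
proof -
  have "norm (g l) \<le> 2 * e" if "e > 0" for e
  proof -
    have "((\<lambda>t. g (x t)) \<longlongrightarrow> g l) at_top" by (rule isCont_tendsto_compose[OF cont lim])
    then have "eventually (\<lambda>t. dist (g (x t)) (g l) < e) at_top" using that by (rule tendstoD)
    moreover have "eventually (\<lambda>t. dist (x t) l < e / 2) at_top"
      using lim that by (intro tendstoD) auto
    ultimately have "eventually (\<lambda>t. dist (g (x t)) (g l) < e \<and> dist (x t) l < e / 2) at_top"
      by (rule eventually_conj)
    then obtain t0 where t0: "\<And>t. t \<ge> t0 \<Longrightarrow> dist (g (x t)) (g l) < e \<and> dist (x t) l < e / 2"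
      unfolding eventually_at_top_linorder by blast
    define t where "t = max 0 t0"
    have der: "(x has_vector_derivative g (x s)) (at s)" if "s \<ge> t" for s
      using x that by (auto simp: forward_solution_def t_def)
    \<comment> \<open>Over one unit of time the solution moves by about \<open>g l\<close>, yet its values are almost equal.\<close>
    let ?d = "\<lambda>s. x s - s *\<^sub>R g l"
    have "norm (?d (t + 1) - ?d t) \<le> e * (t + 1) - e * t"
    proof (rule differentiable_bound_general[where f' = "\<lambda>s. g (x s) - g l" and \<phi>' = "\<lambda>_. e"])
      have d: "(?d has_vector_derivative g (x s) - g l) (at s)" if "s \<ge> t" for s
        using der[OF that] by (auto intro!: derivative_eq_intros)
      then show "continuous_on {t..t + 1} ?d"
        by (intro continuous_at_imp_continuous_on ballI has_vector_derivative_continuous) auto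
      fix s assume s: "t < s" "s < t + 1"
      show "(?d has_vector_derivative g (x s) - g l) (at s)" using d s by simp
      show "((\<lambda>s. e * s) has_vector_derivative e) (at s)"
        by (auto intro!: derivative_eq_intros)
      show "norm (g (x s) - g l) \<le> e" using t0[of s] s by (simp add: t_def dist_norm)
    qed (auto intro!: continuous_intros)
    then have "norm ((x (t + 1) - l) - (x t - l) - g l) \<le> e" by (simp add: algebra_simps)
    moreover have "norm (x (t + 1) - l) < e / 2" "norm (x t - l) < e / 2"
      using t0[of t] t0[of "t + 1"] by (auto simp: t_def dist_norm)
    ultimately show ?thesis
      by (smt (verit, best) field_sum_of_halves norm_minus_commute norm_triangle_ineq2 norm_triangle_ineq4)
  qed
  from this[of "norm (g l) / 4"] show ?thesis by (cases "g l = 0") auto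
qed

lemma flow_forward:
  fixes g :: "'a::euclidean_space \<Rightarrow> 'a"
  assumes "open \<Omega>" and "local_lipschitz {0::real} \<Omega> (\<lambda>_. g)" and "x\<^sub>0 \<in> \<Omega>"
    and "{0..} \<subseteq> existence_ivl g \<Omega> x\<^sub>0"
  shows "forward_solution g \<Omega> (flow g \<Omega> x\<^sub>0)" and "flow g \<Omega> x\<^sub>0 0 = x\<^sub>0"
  using flow_is_solution[OF assms(1-3)] assms(4) by (auto simp: is_solution_def forward_solution_def)

text \<open>
  Existence for all large times, which is part of absorption, implies existence for all
  \<open>t \<ge> 0\<close> because the domain is an interval around \<open>0\<close>. This takes the place of a continuation
  argument for the perturbed systems.
\<close>
lemma absorbing_flow:
  fixes g :: "'a::euclidean_space \<Rightarrow> 'a"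
  assumes "open \<Omega>" and "local_lipschitz {0::real} \<Omega> (\<lambda>_. g)" and "x\<^sub>0 \<in> \<Omega>" and "absorbing g \<Omega> K"
  shows "{0..} \<subseteq> existence_ivl g \<Omega> x\<^sub>0" and "\<exists>t\<ge>0. flow g \<Omega> x\<^sub>0 t \<in> K"
proof -
  have "{x\<^sub>0} \<subseteq> \<Omega> \<and> bounded {x\<^sub>0}" using \<open>x\<^sub>0 \<in> \<Omega>\<close> by simp
  then obtain t0 where t0: "\<And>t. t \<ge> t0 \<Longrightarrow> t \<in> existence_ivl g \<Omega> x\<^sub>0 \<and> flow g \<Omega> x\<^sub>0 t \<in> K"
    using \<open>absorbing g \<Omega> K\<close> unfolding absorbing_def by (metis image_subset_iff singletonI)
  have ivl: "is_interval (existence_ivl g \<Omega> x\<^sub>0)" "0 \<in> existence_ivl g \<Omega> x\<^sub>0"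
    using flow_is_solution[OF assms(1-3)] by (auto simp: is_solution_def)
  show "{0..} \<subseteq> existence_ivl g \<Omega> x\<^sub>0"
  proof
    fix s :: real assume "s \<in> {0..}"
    then have "0 \<le> s" "s \<le> max s t0" "max s t0 \<in> existence_ivl g \<Omega> x\<^sub>0" using t0[of "max s t0"] by auto
    then show "s \<in> existence_ivl g \<Omega> x\<^sub>0" using ivl unfolding is_interval_1 by blast
  qed
  show "\<exists>t\<ge>0. flow g \<Omega> x\<^sub>0 t \<in> K" using t0[of "max 0 t0"] by (intro exI[of _ "max 0 t0"]) auto
qed

section \<open>Continuously differentiable families of vector fields\<close>

text \<open>
  The parameter interval is compact, so \<open>D\<^sub>x f\<close> is bounded on a ball times the whole interval, which
  makes the Lipschitz constant uniform in the parameter.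
\<close>
lemma C1_local_lipschitz:
  fixes f :: "'a::euclidean_space \<Rightarrow> real \<Rightarrow> 'a"
  assumes "open \<Omega>" and "C1_in_state f \<Omega> \<epsilon>\<^sub>0"
  shows "local_lipschitz {-\<epsilon>\<^sub>0..\<epsilon>\<^sub>0} \<Omega> (\<lambda>e x. f x e)"
proof (rule local_lipschitzI)
  fix e x assume "e \<in> {-\<epsilon>\<^sub>0..\<epsilon>\<^sub>0}" "x \<in> \<Omega>"
  obtain Df :: "'a \<Rightarrow> real \<Rightarrow> 'a \<Rightarrow>\<^sub>L 'a" where
    Df: "\<And>e x. e \<in> {-\<epsilon>\<^sub>0..\<epsilon>\<^sub>0} \<Longrightarrow> x \<in> \<Omega> \<Longrightarrow> ((\<lambda>y. f y e) has_derivative blinfun_apply (Df x e)) (at x)"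
    and cont: "continuous_on (\<Omega> \<times> {-\<epsilon>\<^sub>0..\<epsilon>\<^sub>0}) (\<lambda>(x, e). Df x e)"
    using \<open>C1_in_state f \<Omega> \<epsilon>\<^sub>0\<close> unfolding C1_in_state_def by blast
  obtain u where u: "u > 0" "cball x u \<subseteq> \<Omega>"
    using \<open>open \<Omega>\<close> \<open>x \<in> \<Omega>\<close> open_contains_cball by blast
  have "compact ((\<lambda>(x, e). Df x e) ` (cball x u \<times> {-\<epsilon>\<^sub>0..\<epsilon>\<^sub>0}))"
    using u by (intro compact_continuous_image continuous_on_subset[OF cont] compact_Times) auto
  then obtain B where "B > 0" and
    B: "\<forall>D \<in> (\<lambda>(x, e). Df x e) ` (cball x u \<times> {-\<epsilon>\<^sub>0..\<epsilon>\<^sub>0}). norm D \<le> B"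
    using compact_imp_bounded bounded_pos by metis
  have "B-lipschitz_on (cball x u \<inter> \<Omega>) (\<lambda>x. f x s)" if s: "s \<in> {-\<epsilon>\<^sub>0..\<epsilon>\<^sub>0}" for s
  proof (rule lipschitz_onI)
    fix y z assume yz: "y \<in> cball x u \<inter> \<Omega>" "z \<in> cball x u \<inter> \<Omega>"
    have "norm (f y s - f z s) \<le> B * norm (y - z)"
    proof (rule differentiable_bound[of "cball x u" _ "\<lambda>v. blinfun_apply (Df v s)"])
      fix v assume v: "v \<in> cball x u"
      show "((\<lambda>x. f x s) has_derivative blinfun_apply (Df v s)) (at v within cball x u)"
        by (rule has_derivative_at_withinI, rule Df) (use s v u in auto)
      show "onorm (blinfun_apply (Df v s)) \<le> B"
        unfolding norm_blinfun.rep_eq[symmetric] using v s by (intro B[rule_format] image_eqI[of _ _ "(v, s)"]) auto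
    qed (use yz in auto)
    then show "dist (f y s) (f z s) \<le> B * dist y z" by (simp add: dist_norm)
  qed (use \<open>B > 0\<close> in auto)
  then show "\<exists>u>0. \<exists>L. \<forall>t\<in>cball e u \<inter> {-\<epsilon>\<^sub>0..\<epsilon>\<^sub>0}. L-lipschitz_on (cball x u \<inter> \<Omega>) (\<lambda>x. f x t)"
    using \<open>u > 0\<close> by blast
qed

text \<open>
  The linear map \<open>A = D\<^sub>x f(p, 0)\<close> describes all vector fields with small parameter near \<open>p\<close>:
  by joint continuity, \<open>D\<^sub>x f\<close> is within \<open>\<eta>\<close> of \<open>A\<close> on a ball that does not depend on the parameter.
\<close>
lemma C1_near_linear:
  fixes f :: "'a::euclidean_space \<Rightarrow> real \<Rightarrow> 'a"
  assumes "open \<Omega>" and "p \<in> \<Omega>" and "0 < \<epsilon>\<^sub>0" and "C1_in_state f \<Omega> \<epsilon>\<^sub>0"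
  obtains A where "((\<lambda>x. f x 0) has_derivative A) (at p)"
    "\<And>\<eta>. \<eta> > 0 \<Longrightarrow> \<exists>\<rho>>0. cball p \<rho> \<subseteq> \<Omega> \<and> (\<exists>\<delta>>0. \<forall>e\<in>{-\<epsilon>\<^sub>0..\<epsilon>\<^sub>0}. \<bar>e\<bar> < \<delta> \<longrightarrow>
        (\<forall>x\<in>cball p \<rho>. \<forall>y\<in>cball p \<rho>. norm (f x e - f y e - A (x - y)) \<le> \<eta> * norm (x - y)))"
proof -
  obtain Df :: "'a \<Rightarrow> real \<Rightarrow> 'a \<Rightarrow>\<^sub>L 'a" where
    Df: "\<And>e x. e \<in> {-\<epsilon>\<^sub>0..\<epsilon>\<^sub>0} \<Longrightarrow> x \<in> \<Omega> \<Longrightarrow> ((\<lambda>y. f y e) has_derivative blinfun_apply (Df x e)) (at x)"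
    and cont: "continuous_on (\<Omega> \<times> {-\<epsilon>\<^sub>0..\<epsilon>\<^sub>0}) (\<lambda>(x, e). Df x e)"
    using \<open>C1_in_state f \<Omega> \<epsilon>\<^sub>0\<close> unfolding C1_in_state_def by blast
  define A where "A = Df p 0"
  show thesis
  proof (rule that[of "blinfun_apply A"])
    show "((\<lambda>x. f x 0) has_derivative blinfun_apply A) (at p)"
      unfolding A_def using assms by (intro Df) auto
    fix \<eta> :: real assume "\<eta> > 0"
    have "(p, 0) \<in> \<Omega> \<times> {-\<epsilon>\<^sub>0..\<epsilon>\<^sub>0}" using assms by auto
    from cont[unfolded continuous_on_iff, rule_format, OF this \<open>\<eta> > 0\<close>]
    obtain d where "d > 0" and
      d: "\<And>x e. x \<in> \<Omega> \<Longrightarrow> e \<in> {-\<epsilon>\<^sub>0..\<epsilon>\<^sub>0} \<Longrightarrow> dist (x, e) (p, 0) < d \<Longrightarrow> dist (Df x e) A < \<eta>"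
      unfolding A_def by fastforce
    obtain u where u: "u > 0" "cball p u \<subseteq> \<Omega>"
      using \<open>open \<Omega>\<close> \<open>p \<in> \<Omega>\<close> open_contains_cball by blast
    define \<rho> where "\<rho> = min u (d / 3)"
    have \<rho>: "\<rho> > 0" "cball p \<rho> \<subseteq> \<Omega>" "\<rho> \<le> d / 3" using u \<open>d > 0\<close> by (auto simp: \<rho>_def)
    have bnd: "norm (f x e - f y e - A (x - y)) \<le> \<eta> * norm (x - y)"
      if e: "e \<in> {-\<epsilon>\<^sub>0..\<epsilon>\<^sub>0}" "\<bar>e\<bar> < d / 3" and xy: "x \<in> cball p \<rho>" "y \<in> cball p \<rho>" for e x y
    proof -
      have "norm ((f x e - A x) - (f y e - A y)) \<le> \<eta> * norm (x - y)"
      proof (rule differentiable_bound[of "cball p \<rho>" _ "\<lambda>v. blinfun_apply (Df v e - A)"])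
        fix v assume v: "v \<in> cball p \<rho>"
        have "((\<lambda>x. f x e - A x) has_derivative (\<lambda>h. Df v e h - A h)) (at v)"
          using v e \<rho> by (intro has_derivative_diff Df) (auto intro!: bounded_linear_imp_has_derivative blinfun.bounded_linear_right)
        then show "((\<lambda>x. f x e - A x) has_derivative blinfun_apply (Df v e - A)) (at v within cball p \<rho>)"
          by (simp add: minus_blinfun.rep_eq[abs_def] has_derivative_at_withinI)
        have "dist (v, e) (p, 0) \<le> dist v p + dist e 0"
          using sqrt_sum_squares_le_sum_abs[of "dist v p" "dist e 0"] by (simp add: dist_prod_def)
        also have "\<dots> < d" using v e \<rho> \<open>d > 0\<close> by (simp add: dist_commute)
        finally have "dist (Df v e) A < \<eta>" using d[of v e] v e \<rho> by auto
        then show "onorm (blinfun_apply (Df v e - A)) \<le> \<eta>"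
          unfolding norm_blinfun.rep_eq[symmetric] by (simp add: dist_norm)
      qed (use xy in auto)
      then show ?thesis by (simp add: blinfun.diff_right algebra_simps)
    qed
    have "d / 3 > 0" using \<open>d > 0\<close> by simp
    with bnd \<rho> show "\<exists>\<rho>>0. cball p \<rho> \<subseteq> \<Omega> \<and> (\<exists>\<delta>>0. \<forall>e\<in>{-\<epsilon>\<^sub>0..\<epsilon>\<^sub>0}. \<bar>e\<bar> < \<delta> \<longrightarrow>
        (\<forall>x\<in>cball p \<rho>. \<forall>y\<in>cball p \<rho>. norm (f x e - f y e - A (x - y)) \<le> \<eta> * norm (x - y)))"
      by blast
  qed
qed

section \<open>Contraction from exponential stability\<close>

text \<open>
  A robust form of \<open>\<parallel>exp (T * A)\<parallel> \<le> 1/2\<close> that does not mention the matrix exponential: curves solving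
  \<open>w' = A w\<close> up to a relative error \<open>\<eta>\<close> and an absolute error \<open>\<kappa>\<close> are halved after time \<open>T\<close>, up to a multiple
  of \<open>\<kappa>\<close>, and grow at most by the factor \<open>M\<close> in between. As in \<open>gronwall_bootstrap\<close>, the errors are
  controlled only inside a ball of radius \<open>\<rho>\<close>. Both \<open>x - p\<close> for a solution \<open>x\<close> of the perturbed system and
  the difference of two such solutions are curves of this kind.
\<close>
definition contracts :: "('a::euclidean_space \<Rightarrow> 'a) \<Rightarrow> real \<Rightarrow> real \<Rightarrow> real \<Rightarrow> bool" where
  "contracts A \<eta> T M \<longleftrightarrow>
     (\<forall>w w' \<kappa> \<rho>. 0 \<le> \<kappa> \<longrightarrow> M * (norm (w 0) + \<kappa>) < \<rho> \<longrightarrow>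
        (\<forall>t\<in>{0..T}. (w has_vector_derivative w' t) (at t) \<and>
           (norm (w t) \<le> \<rho> \<longrightarrow> norm (w' t - A (w t)) \<le> \<eta> * norm (w t) + \<kappa>)) \<longrightarrow>
        norm (w T) \<le> norm (w 0) / 2 + M * \<kappa> \<and> (\<forall>t\<in>{0..T}. norm (w t) \<le> M * (norm (w 0) + \<kappa>)))"

lemma contractsD:
  assumes "contracts A \<eta> T M" and "0 \<le> \<kappa>" and "M * (norm (w 0) + \<kappa>) < \<rho>"
    and "\<And>t. t \<in> {0..T} \<Longrightarrow> (w has_vector_derivative w' t) (at t)"
    and "\<And>t. t \<in> {0..T} \<Longrightarrow> norm (w t) \<le> \<rho> \<Longrightarrow> norm (w' t - A (w t)) \<le> \<eta> * norm (w t) + \<kappa>"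
  shows "norm (w T) \<le> norm (w 0) / 2 + M * \<kappa>"
    and "\<And>t. t \<in> {0..T} \<Longrightarrow> norm (w t) \<le> M * (norm (w 0) + \<kappa>)"
  using assms unfolding contracts_def by blast+

text \<open>
  Exponential stability of the nonlinear system is transferred to approximate solutions of the
  linearised equation by comparing them with magnified nonlinear solutions that start very close to
  \<open>p\<close>. Neither the spectrum of \<open>A\<close> nor a Lyapunov function enters.
\<close>
lemma exponential_stability_contracts:
  fixes g :: "'a::euclidean_space \<Rightarrow> 'a"
  assumes "open \<Omega>" and lip: "local_lipschitz {0::real} \<Omega> (\<lambda>_. g)"
    and "p \<in> \<Omega>" and "g p = 0" and A: "(g has_derivative A) (at p)"
    and les: "locally_exponentially_stable g \<Omega> p"
  obtains T \<eta> M where "T > 0" "\<eta> > 0" "M > 0" "contracts A \<eta> T M"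
proof -
  obtain C l \<delta> where pos: "C > 0" "l > 0" "\<delta> > 0"
    and exps: "\<And>y t. y \<in> \<Omega> \<Longrightarrow> norm (y - p) < \<delta> \<Longrightarrow> t \<ge> 0 \<Longrightarrow>
      t \<in> existence_ivl g \<Omega> y \<and> norm (flow g \<Omega> y t - p) \<le> C * exp (- l * t) * norm (y - p)"
    using les unfolding locally_exponentially_stable_def by blast
  have lin: "bounded_linear A" using A by (rule has_derivative_bounded_linear)
  then obtain a where a: "a > 0" "\<And>v. norm (A v) \<le> a * norm v"
    using bounded_linear.pos_bounded by (metis mult.commute)
  \<comment> \<open>Within time \<open>T\<close> the exponential estimate contracts to a quarter; the other quarter of the
    allowed one half pays for the approximation errors.\<close>
  define T where "T = max 1 (ln (4 * C) / l)"
  have T: "T \<ge> 1" "C * exp (- l * T) \<le> 1 / 4"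
  proof -
    show "T \<ge> 1" by (simp add: T_def)
    have "ln (4 * C) / l \<le> T" by (simp add: T_def)
    then have "ln (4 * C) \<le> l * T" using pos by (simp add: field_simps)
    then have "exp (ln (4 * C)) \<le> exp (l * T)" by simp
    then have "4 * C \<le> exp (l * T)" using pos by simp
    then show "C * exp (- l * T) \<le> 1 / 4" by (simp add: exp_minus field_simps)
  qed
  define M1 where "M1 = exp ((a + 1) * T) * (1 + T)"
  have "exp ((a + 1) * T) \<ge> 1" using a T by simp
  then have M1: "M1 > 0" using T by (simp add: M1_def)
  define \<eta> where "\<eta> = min 1 (1 / (4 * (M1 * (M1 + C))))"
  have \<eta>: "\<eta> > 0" "\<eta> \<le> 1" "\<eta> * (M1 * (M1 + C)) \<le> 1 / 4"
  proof -
    have pZ: "M1 * (M1 + C) > 0" using M1 pos by simp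
    moreover have "\<eta> \<le> 1 / (4 * (M1 * (M1 + C)))" by (simp add: \<eta>_def)
    ultimately have "\<eta> * (4 * (M1 * (M1 + C))) \<le> 1" by (subst (asm) pos_le_divide_eq) auto
    then show "\<eta> * (M1 * (M1 + C)) \<le> 1 / 4" by linarith
    show "\<eta> > 0" unfolding \<eta>_def min_less_iff_conj using pZ by (intro conjI divide_pos_pos) auto
    show "\<eta> \<le> 1" by (simp add: \<eta>_def)
  qed
  define M where "M = M1 + 1"
  obtain d where "d > 0" and d: "\<And>y. norm (y - p) < d \<Longrightarrow> norm (g y - A (y - p)) \<le> \<eta> * norm (y - p)"
    using A[unfolded has_derivative_at_alt, THEN conjunct2, rule_format, OF \<open>\<eta> > 0\<close>]
    unfolding \<open>g p = 0\<close> diff_0_right by blast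
  obtain h0 where h0: "h0 > 0" "cball p h0 \<subseteq> \<Omega>"
    using \<open>open \<Omega>\<close> \<open>p \<in> \<Omega>\<close> open_contains_cball by blast
  define h where "h = min h0 (min (\<delta> / 2) (d / (2 * C)))"
  have h: "h > 0" "h \<le> h0" "h < \<delta>" "C * h < d"
  proof -
    show "h > 0" "h \<le> h0" "h < \<delta>" using h0 pos \<open>d > 0\<close> by (auto simp: h_def)
    have "h \<le> d / (2 * C)" by (simp add: h_def)
    then have "C * h \<le> d / 2" using pos by (simp add: field_simps)
    then show "C * h < d" using \<open>d > 0\<close> by simp
  qed
  have "contracts A \<eta> T M"
    unfolding contracts_def
  proof (intro allI impI)
    fix w w' \<kappa> \<rho>
    assume "0 \<le> \<kappa>" and small: "M * (norm (w 0) + \<kappa>) < \<rho>"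
      and w: "\<forall>t\<in>{0..T}. (w has_vector_derivative w' t) (at t) \<and>
           (norm (w t) \<le> \<rho> \<longrightarrow> norm (w' t - A (w t)) \<le> \<eta> * norm (w t) + \<kappa>)"
    define N where "N = norm (w 0) + \<kappa>"
    have N: "N \<ge> 0" using \<open>0 \<le> \<kappa>\<close> by (simp add: N_def)
    then have small1: "M1 * N < \<rho>" using small unfolding M_def N_def by (simp add: algebra_simps)
    have grow: "(norm (w 0) + \<kappa> * t) * exp ((a + 1) * t) \<le> M1 * N" if "t \<in> {0..T}" for t
    proof -
      have "norm (w 0) + \<kappa> * t \<le> (norm (w 0) + \<kappa>) * (1 + t)"
        using that \<open>0 \<le> \<kappa>\<close> by (simp add: algebra_simps)
      also have "\<dots> \<le> N * (1 + T)" unfolding N_def using that N by (intro mult_left_mono) (auto simp: N_def)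
      finally have "(norm (w 0) + \<kappa> * t) * exp ((a + 1) * t) \<le> N * (1 + T) * exp ((a + 1) * T)"
        using that a N \<open>0 \<le> \<kappa>\<close> T by (intro mult_mono) auto
      then show ?thesis by (simp add: M1_def algebra_simps)
    qed
    have wbound: "norm (w t) \<le> M1 * N" if t: "t \<in> {0..T}" for t
    proof -
      have "norm (w t) \<le> (norm (w 0) + \<kappa> * t) * exp ((a + 1) * t)"
      proof (rule gronwall_bootstrap[where w' = w' and \<rho> = \<rho> and T = T])
        fix t assume t: "t \<in> {0..T}" "norm (w t) \<le> \<rho>"
        have "norm (w' t) \<le> norm (w' t - A (w t)) + norm (A (w t))"
          by (metis diff_add_cancel norm_triangle_ineq)
        also have "\<dots> \<le> (\<eta> * norm (w t) + \<kappa>) + a * norm (w t)" using w t a by (intro add_mono) auto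
        also have "\<dots> \<le> (1 * norm (w t) + \<kappa>) + a * norm (w t)" using \<eta> by (intro add_mono mult_right_mono) auto
        finally show "norm (w' t) \<le> (a + 1) * norm (w t) + \<kappa>" by (simp add: algebra_simps)
      next
        show "(norm (w 0) + \<kappa> * T) * exp ((a + 1) * T) < \<rho>"
          using grow[of T] small1 T by auto
      qed (use w a t \<open>0 \<le> \<kappa>\<close> in auto)
      with grow[OF t] show ?thesis by linarith
    qed
    have "M1 * N \<le> M * N" using N by (simp add: M_def algebra_simps)
    then have wM: "\<forall>t\<in>{0..T}. norm (w t) \<le> M * (norm (w 0) + \<kappa>)"
      using wbound unfolding N_def by force
    have "norm (w T) \<le> norm (w 0) / 2 + M * \<kappa>"
    proof (cases "w 0 = 0")
      case True
      then show ?thesis using wM T by auto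
    next
      case False
      \<comment> \<open>The solution \<open>x\<close> starts at distance \<open>h\<close> from \<open>p\<close> in the direction of \<open>w 0\<close>; magnified by \<open>s\<close>
        about \<open>p\<close> it is a curve \<open>u\<close> with \<open>u 0 = w 0\<close> that almost solves the linear equation and decays
        exponentially.\<close>
      define s where "s = norm (w 0) / h"
      define y where "y = p + (1 / s) *\<^sub>R w 0"
      have s: "s > 0" using False h by (simp add: s_def)
      have yp: "norm (y - p) = h" using False h by (simp add: y_def s_def)
      then have "y \<in> cball p h0" using h by (simp add: dist_norm norm_minus_commute)
      then have y: "y \<in> \<Omega>" "norm (y - p) < \<delta>" using h0 h yp by auto
      define x where "x = flow g \<Omega> y"
      note sol = flow_is_solution[OF \<open>open \<Omega>\<close> lip y(1), folded x_def, unfolded is_solution_def]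
      define u where "u = (\<lambda>t. s *\<^sub>R (x t - p))"
      have xder: "(x has_vector_derivative g (x t)) (at t)" if "t \<ge> 0" for t
        using sol exps[OF y that] by blast
      have xb: "norm (x t - p) \<le> C * exp (- l * t) * h" if "t \<ge> 0" for t
        using exps[OF y that] yp unfolding x_def by simp
      have ub: "norm (u t) \<le> C * exp (- l * t) * norm (w 0)" if "t \<ge> 0" for t
      proof -
        have "s * norm (x t - p) \<le> s * (C * exp (- l * t) * h)"
          using xb[OF that] s by (intro mult_left_mono) auto
        also have "\<dots> = C * exp (- l * t) * (s * h)" by (simp only: mult_ac)
        also have "s * h = norm (w 0)" using h by (simp add: s_def)
        finally show ?thesis using s by (simp add: u_def)
      qed
      have expC: "C * exp (- l * t) * q \<le> C * q" if "t \<ge> 0" "q \<ge> 0" for t q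
        using that pos by (simp add: mult_right_mono mult_left_le)
      have u0: "u 0 = w 0" using sol s by (simp add: u_def y_def)
      define \<kappa>' where "\<kappa>' = \<eta> * (M1 * N + C * norm (w 0)) + \<kappa>"
      have \<kappa>': "\<kappa>' \<ge> 0" using \<eta> M1 N pos \<open>0 \<le> \<kappa>\<close> by (simp add: \<kappa>'_def)
      have "norm (w T - u T) \<le> (norm (w 0 - u 0) + \<kappa>' * T) * exp (a * T)"
      proof (rule gronwall_bootstrap[where w = "\<lambda>t. w t - u t" and w' = "\<lambda>t. w' t - s *\<^sub>R g (x t)" and T = T
            and \<rho> = "(norm (w 0 - u 0) + \<kappa>' * T) * exp (a * T) + 1"])
        fix t assume t: "t \<in> {0..T}"
        show "((\<lambda>t. w t - u t) has_vector_derivative w' t - s *\<^sub>R g (x t)) (at t)"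
          unfolding u_def using w t by (auto intro!: derivative_eq_intros xder)
        have 1: "norm (w' t - A (w t)) \<le> \<eta> * norm (w t) + \<kappa>"
          using w wbound[OF t] small1 t by auto
        have 2: "norm (s *\<^sub>R g (x t) - A (u t)) \<le> \<eta> * norm (u t)"
        proof -
          have "norm (x t - p) < d" using xb[of t] expC[of t h] h t by auto
          then have "s * norm (g (x t) - A (x t - p)) \<le> s * (\<eta> * norm (x t - p))"
            using s by (intro mult_left_mono d) auto
          moreover have "s *\<^sub>R g (x t) - A (u t) = s *\<^sub>R (g (x t) - A (x t - p))"
            unfolding u_def linear_cmul[OF bounded_linear.linear[OF lin]] by (simp only: scaleR_diff_right)
          ultimately show ?thesis using s by (simp add: u_def)
        qed
        have "w' t - s *\<^sub>R g (x t) = (w' t - A (w t)) - (s *\<^sub>R g (x t) - A (u t)) + A (w t - u t)"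
          using bounded_linear.linear[OF lin] by (simp add: linear_diff)
        then have "norm (w' t - s *\<^sub>R g (x t)) \<le> (\<eta> * norm (w t) + \<kappa>) + \<eta> * norm (u t) + a * norm (w t - u t)"
          using 1 2 a(2)[of "w t - u t"]
          by (smt (verit, best) norm_triangle_ineq norm_triangle_ineq4)
        also have "\<dots> \<le> (\<eta> * (M1 * N) + \<kappa>) + \<eta> * (C * norm (w 0)) + a * norm (w t - u t)"
          using wbound[OF t] ub[of t] expC[of t "norm (w 0)"] t \<eta> a(1)
          by (intro add_mono mult_left_mono) auto
        finally show "norm (w' t - s *\<^sub>R g (x t)) \<le> a * norm (w t - u t) + \<kappa>'"
          by (simp add: \<kappa>'_def algebra_simps)
      qed (use \<kappa>' a T in auto)
      also have "\<dots> = \<kappa>' * (T * exp (a * T))" using u0 by simp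
      also have "\<dots> \<le> \<kappa>' * M1"
      proof (intro mult_left_mono \<kappa>')
        have "exp (a * T) \<le> exp ((a + 1) * T)" using T by simp
        then show "T * exp (a * T) \<le> M1" unfolding M1_def using T
          by (subst mult.commute) (intro mult_mono, auto)
      qed
      also have "\<dots> = (\<eta> * (M1 * (M1 + C))) * norm (w 0) + (\<eta> * (M1 * M1)) * \<kappa> + M1 * \<kappa>"
        by (simp add: \<kappa>'_def N_def algebra_simps)
      also have "\<dots> \<le> 1 / 4 * norm (w 0) + 1 * \<kappa> + M1 * \<kappa>"
      proof (intro add_mono mult_right_mono \<eta>)
        have "\<eta> * (M1 * M1) \<le> \<eta> * (M1 * (M1 + C))" using \<eta> M1 pos by (intro mult_left_mono) auto
        then show "\<eta> * (M1 * M1) \<le> 1" using \<eta> by linarith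
      qed (use \<open>0 \<le> \<kappa>\<close> in auto)
      finally have "norm (w T - u T) \<le> 1 / 4 * norm (w 0) + M * \<kappa>" by (simp add: M_def algebra_simps)
      moreover have "norm (u T) \<le> 1 / 4 * norm (w 0)"
      proof -
        have "C * exp (- l * T) * norm (w 0) \<le> 1 / 4 * norm (w 0)"
          using T by (intro mult_right_mono) auto
        then show ?thesis using ub[of T] T by linarith
      qed
      moreover have "norm (w T) \<le> norm (w T - u T) + norm (u T)"
        by (metis diff_add_cancel norm_triangle_ineq)
      ultimately show ?thesis by linarith
    qed
    with wM show "norm (w T) \<le> norm (w 0) / 2 + M * \<kappa> \<and> (\<forall>t\<in>{0..T}. norm (w t) \<le> M * (norm (w 0) + \<kappa>))"
      by blast
  qed
  moreover have "T > 0" "M > 0" using T M1 by (auto simp: M_def)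
  ultimately show thesis using that \<eta> by blast
qed

section \<open>Dynamics in a trapping ball\<close>

lemma geometric_decay:
  fixes d :: "real \<Rightarrow> real"
  assumes "T > 0" and "M \<ge> 0"
    and nonneg: "\<And>s. s \<ge> 0 \<Longrightarrow> 0 \<le> d s"
    and half: "\<And>s. s \<ge> 0 \<Longrightarrow> d (s + T) \<le> d s / 2"
    and grow: "\<And>s t. s \<ge> 0 \<Longrightarrow> t \<in> {0..T} \<Longrightarrow> d (s + t) \<le> M * d s"
    and "t \<ge> 0"
  shows "d t \<le> M * (1 / 2) ^ nat \<lfloor>t / T\<rfloor> * d 0"
proof -
  have iter: "d (real k * T) \<le> (1 / 2) ^ k * d 0" for k
  proof (induction k)
    case (Suc k)
    have "d (real k * T + T) \<le> d (real k * T) / 2" using \<open>T > 0\<close> by (intro half) auto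
    with Suc show ?case by (simp add: algebra_simps)
  qed simp
  define k where "k = nat \<lfloor>t / T\<rfloor>"
  have k: "real k = of_int \<lfloor>t / T\<rfloor>" using assms by (simp add: k_def)
  have "real k \<le> t / T" "t / T < real k + 1" unfolding k by linarith+
  then have "real k * T \<le> t" "t \<le> real k * T + T" using \<open>T > 0\<close> by (simp_all add: field_simps)
  then have "d (real k * T + (t - real k * T)) \<le> M * d (real k * T)"
    using \<open>T > 0\<close> by (intro grow) auto
  also have "\<dots> \<le> M * ((1 / 2) ^ k * d 0)" using iter \<open>M \<ge> 0\<close> by (rule mult_left_mono)
  finally show ?thesis by (simp add: k_def mult.assoc)
qed

lemma geometric_factor_tendsto_0:
  assumes "T > 0"
  shows "((\<lambda>t. (1 / 2 :: real) ^ nat \<lfloor>t / T\<rfloor>) \<longlongrightarrow> 0) at_top"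
proof -
  have "filterlim (\<lambda>t. t / T) at_top at_top"
    unfolding filterlim_at_top
  proof
    fix Z
    show "eventually (\<lambda>t. Z \<le> t / T) at_top"
      using eventually_ge_at_top[of "Z * T"] by eventually_elim (use assms in \<open>simp add: field_simps\<close>)
  qed
  then have "filterlim (\<lambda>t. nat \<lfloor>t / T\<rfloor>) sequentially at_top"
    by (intro filterlim_compose[OF filterlim_nat_sequentially] filterlim_compose[OF filterlim_floor_sequentially])
  moreover have "(\<lambda>n. (1 / 2 :: real) ^ n) \<longlonglongrightarrow> 0" by (rule LIMSEQ_power_zero) simp
  ultimately show ?thesis by (rule filterlim_compose[rotated])
qed

text \<open>
  A vector field close to \<open>A\<close> on the ball of radius \<open>\<rho>\<close> around \<open>p\<close>, with a residual \<open>g p\<close> so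
  small that solutions from the ball of radius \<open>r\<close> are back in it after one period and do not
  leave the larger ball in between. The centre \<open>p\<close> is the equilibrium of the unperturbed system; it
  need not be one of \<open>g\<close>.
\<close>
locale trapping_ball =
  fixes g :: "'a::euclidean_space \<Rightarrow> 'a" and \<Omega> and p and A and \<eta> T M \<rho> r \<kappa> :: real
  assumes contracts: "contracts A \<eta> T M" and T: "T > 0" and M: "M > 0" and \<kappa>: "\<kappa> \<ge> 0"
    and \<Omega>: "open \<Omega>" "cball p \<rho> \<subseteq> \<Omega>" and cont: "continuous_on \<Omega> g"
    and near_linear: "\<And>x y. x \<in> cball p \<rho> \<Longrightarrow> y \<in> cball p \<rho> \<Longrightarrow>
      norm (g x - g y - A (x - y)) \<le> \<eta> * norm (x - y)"
    and residual: "norm (g p) \<le> \<kappa>"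
    and r: "r > 0" and small: "M * (r + \<kappa>) < \<rho>" "4 * M * \<kappa> \<le> r"
begin

lemma rho_pos: "\<rho> > 0"
  using M r \<kappa> small(1) by (smt (verit, best) mult_pos_pos)

lemma one_period:
  assumes x: "forward_solution g \<Omega> x" and x0: "norm (x 0 - p) \<le> r"
  shows "norm (x T - p) \<le> norm (x 0 - p) / 2 + M * \<kappa>" "\<And>t. t \<in> {0..T} \<Longrightarrow> norm (x t - p) \<le> \<rho>"
proof -
  have le: "M * (norm (x 0 - p) + \<kappa>) \<le> M * (r + \<kappa>)" using x0 M by (intro mult_left_mono) auto
  then have lt: "M * (norm (x 0 - p) + \<kappa>) < \<rho>" using small by linarith
  have der: "((\<lambda>t. x t - p) has_vector_derivative g (x t)) (at t)" if t: "t \<in> {0..T}" for t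
  proof -
    have "(x has_vector_derivative g (x t)) (at t)" using x t by (simp add: forward_solution_def)
    then show ?thesis by (auto intro!: derivative_eq_intros)
  qed
  have bound: "norm (g (x t) - A (x t - p)) \<le> \<eta> * norm (x t - p) + \<kappa>" if "norm (x t - p) \<le> \<rho>" for t
  proof -
    have "norm (g (x t) - g p - A (x t - p)) \<le> \<eta> * norm (x t - p)"
      using that rho_pos by (intro near_linear) (auto simp: dist_norm norm_minus_commute)
    then show ?thesis
      using residual norm_triangle_ineq[of "g (x t) - g p - A (x t - p)" "g p"] by (simp add: algebra_simps)
  qed
  note c = contractsD[OF contracts \<kappa>, of "\<lambda>t. x t - p", OF lt der bound]
  show "norm (x T - p) \<le> norm (x 0 - p) / 2 + M * \<kappa>" using c(1) by blast
  show "norm (x t - p) \<le> \<rho>" if "t \<in> {0..T}" for t using c(2)[OF _ _ that] lt by force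
qed

text \<open>
  The estimate over one period repeats, since after each period the solution is again within \<open>r\<close>
  of the centre.
\<close>
lemma trapped:
  assumes x: "forward_solution g \<Omega> x" and x0: "norm (x 0 - p) \<le> r" and "t \<ge> 0"
  shows "norm (x t - p) \<le> \<rho>"
proof -
  have start: "norm (x (real k * T) - p) \<le> r" for k
  proof (induction k)
    case (Suc k)
    have "forward_solution g \<Omega> (\<lambda>t. x (real k * T + t))"
      using x T by (intro forward_solution_shift) auto
    from one_period(1)[OF this] Suc have "norm (x (real k * T + T) - p) \<le> r / 2 + M * \<kappa>" by simp
    then show ?case using small r by (simp add: algebra_simps)
  qed (use x0 in simp)
  define k where "k = nat \<lfloor>t / T\<rfloor>"
  have k: "real k = of_int \<lfloor>t / T\<rfloor>" using \<open>t \<ge> 0\<close> T by (simp add: k_def)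
  have "real k \<le> t / T" "t / T < real k + 1" unfolding k by linarith+
  then have kt: "real k * T \<le> t" "t \<le> real k * T + T" using T by (simp_all add: field_simps)
  have "forward_solution g \<Omega> (\<lambda>t. x (real k * T + t))"
    using x T by (intro forward_solution_shift) auto
  from one_period(2)[OF this, of "t - real k * T"] start[of k] kt show ?thesis by simp
qed

text \<open>
  The residual cancels in the difference of two solutions, so here the contraction has no
  remainder.
\<close>
lemma trapped_solutions_contract:
  assumes x: "forward_solution g \<Omega> x" "\<And>t. t \<ge> 0 \<Longrightarrow> norm (x t - p) \<le> \<rho>"
    and y: "forward_solution g \<Omega> y" "\<And>t. t \<ge> 0 \<Longrightarrow> norm (y t - p) \<le> \<rho>"
    and "t \<ge> 0"
  shows "norm (x t - y t) \<le> M * (1 / 2) ^ nat \<lfloor>t / T\<rfloor> * norm (x 0 - y 0)"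
proof -
  have *: "norm (x (s + T) - y (s + T)) \<le> norm (x s - y s) / 2 \<and>
      (\<forall>t\<in>{0..T}. norm (x (s + t) - y (s + t)) \<le> M * norm (x s - y s))" if s: "s \<ge> 0" for s
  proof -
    let ?w = "\<lambda>t. x (s + t) - y (s + t)" and ?w' = "\<lambda>t. g (x (s + t)) - g (y (s + t))"
    have der: "(?w has_vector_derivative ?w' t) (at t)" if "t \<in> {0..T}" for t
      using forward_solution_shift[OF x(1) s] forward_solution_shift[OF y(1) s] that
      by (intro has_vector_derivative_diff) (auto simp: forward_solution_def)
    have bound: "norm (?w' t - A (?w t)) \<le> \<eta> * norm (?w t) + 0" if "t \<in> {0..T}" for t
      using x(2)[of "s + t"] y(2)[of "s + t"] that s near_linear[of "x (s + t)" "y (s + t)"]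
      by (auto simp: dist_norm norm_minus_commute)
    note c = contractsD[OF contracts, of 0 ?w "M * norm (x s - y s) + 1" ?w']
    show ?thesis
      using c(1)[OF _ _ der bound] c(2)[OF _ _ der bound] by (simp add: add.commute)
  qed
  show ?thesis
    by (rule geometric_decay[of T M "\<lambda>t. norm (x t - y t)"]) (use * T M \<open>t \<ge> 0\<close> in auto)
qed

text \<open>
  This yields existence of an equilibrium without the implicit function theorem: every trapped
  solution is contracted towards its own time shifts, hence converges, and limits of solutions are
  equilibria.
\<close>
lemma trapped_solution_converges:
  assumes x: "forward_solution g \<Omega> x" "\<And>t. t \<ge> 0 \<Longrightarrow> norm (x t - p) \<le> \<rho>"
  obtains q where "norm (q - p) \<le> \<rho>" "g q = 0" "(x \<longlongrightarrow> q) at_top"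
proof -
  define c where "c = (\<lambda>t. M * (1 / 2) ^ nat \<lfloor>t / T\<rfloor> * (2 * \<rho>))"
  have c0: "(c \<longlongrightarrow> 0) at_top"
    unfolding c_def using tendsto_mult_left_zero[OF tendsto_mult_right_zero[OF geometric_factor_tendsto_0[OF T], of M], of "2 * \<rho>"] by simp
  \<comment> \<open>Comparing \<open>x\<close> with its own time shift shows the Cauchy property.\<close>
  have close: "norm (x t - x t') \<le> c t" if "0 \<le> t" "t \<le> t'" for t t'
  proof -
    define s where "s = t' - t"
    have s: "s \<ge> 0" using that by (simp add: s_def)
    have "norm (x t - x (s + t)) \<le> M * (1 / 2) ^ nat \<lfloor>t / T\<rfloor> * norm (x 0 - x (s + 0))"
      by (rule trapped_solutions_contract[OF x, of "\<lambda>t. x (s + t)"])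
        (use x s that in \<open>auto intro: forward_solution_shift\<close>)
    also have "\<dots> \<le> c t" unfolding c_def
    proof (rule mult_left_mono)
      show "norm (x 0 - x (s + 0)) \<le> 2 * \<rho>"
        using x(2)[of 0] x(2)[of s] s norm_triangle_ineq4[of "x 0 - p" "x s - p"] by simp
    qed (use M in auto)
    finally show ?thesis by (simp add: s_def)
  qed
  have cn: "(\<lambda>n. c (real n)) \<longlonglongrightarrow> 0" by (rule filterlim_compose[OF c0 filterlim_real_sequentially])
  have "Cauchy (\<lambda>n. x (real n))"
  proof (rule metric_CauchyI)
    fix e :: real assume "e > 0"
    then have "eventually (\<lambda>n. c (real n) < e / 2) sequentially" using cn by (intro order_tendstoD(2)) auto
    then obtain N where N: "c (real N) < e / 2" unfolding eventually_sequentially by blast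
    have "dist (x (real m)) (x (real n)) < e" if "m \<ge> N" "n \<ge> N" for m n
    proof -
      have "norm (x (real N) - x (real m)) < e / 2" "norm (x (real N) - x (real n)) < e / 2"
        using close[of "real N" "real m"] close[of "real N" "real n"] N that by auto
      then show ?thesis
        using norm_triangle_ineq4[of "x (real N) - x (real n)" "x (real N) - x (real m)"] by (simp add: dist_norm)
    qed
    then show "\<exists>N. \<forall>m\<ge>N. \<forall>n\<ge>N. dist (x (real m)) (x (real n)) < e" by blast
  qed
  then obtain q where q: "(\<lambda>n. x (real n)) \<longlonglongrightarrow> q"
    using Cauchy_convergent convergent_def by blast
  have qt: "norm (x t - q) \<le> c t" if "t \<ge> 0" for t
  proof (rule Lim_norm_ubound[OF sequentially_bot])
    show "(\<lambda>n. x t - x (real n)) \<longlonglongrightarrow> x t - q" by (intro tendsto_intros q)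
    have "eventually (\<lambda>n. n \<ge> nat \<lceil>t\<rceil>) sequentially" by (rule eventually_ge_at_top)
    then show "eventually (\<lambda>n. norm (x t - x (real n)) \<le> c t) sequentially"
      by eventually_elim (use that in \<open>auto intro!: close simp: nat_ceiling_le_eq\<close>)
  qed
  have "((\<lambda>t. x t - q) \<longlongrightarrow> 0) at_top"
    using qt by (intro Lim_null_comparison[OF _ c0] eventually_mono[OF eventually_ge_at_top[of 0]]) auto
  then have lim: "(x \<longlongrightarrow> q) at_top" by (simp add: LIM_zero_iff)
  have "norm (q - p) \<le> \<rho>"
    by (rule Lim_norm_ubound[of sequentially "\<lambda>n. x (real n) - p"]) (use x q in \<open>auto intro!: tendsto_intros\<close>)
  moreover from this have "q \<in> \<Omega>" using \<Omega> by (auto simp: dist_norm norm_minus_commute)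
  then have "isCont g q" using cont \<Omega> by (simp add: continuous_on_eq_continuous_at)
  then have "g q = 0" by (rule limit_is_equilibrium[OF x(1) lim])
  ultimately show thesis using lim that by blast
qed

text \<open>
  The equilibrium lies well inside the ball of radius \<open>r\<close>, so all initial values near it are
  trapped; Lyapunov stability rests on this.
\<close>
lemma equilibrium_near_center:
  assumes "g q = 0" and "norm (q - p) \<le> \<rho>"
  shows "norm (q - p) \<le> r / 2"
proof -
  \<comment> \<open>The constant curve \<open>q - p\<close> solves the linear equation up to the errors \<open>\<eta>\<close> and \<open>\<kappa>\<close>, so it is
    halved up to \<open>M * \<kappa>\<close>.\<close>
  define w where "w = q - p"
  have "norm (g q - g p - A w) \<le> \<eta> * norm w"
    using assms rho_pos unfolding w_def by (intro near_linear) (auto simp: dist_norm norm_minus_commute)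
  then have "norm (0 - A w) \<le> \<eta> * norm w + \<kappa>"
    using residual norm_triangle_ineq[of "g q - g p - A w" "g p"] \<open>g q = 0\<close> by simp
  then have "norm w \<le> norm w / 2 + M * \<kappa>"
    using contractsD(1)[OF contracts \<kappa>, of "\<lambda>_. w" "M * (norm w + \<kappa>) + 1" "\<lambda>_. 0"] by auto
  then show ?thesis using small(2) by (simp add: w_def)
qed

text \<open>
  Once all flows enter the ball, the local contraction decides their fate: any flow and the constant
  solution at the equilibrium end up in the same ball and approach each other.
\<close>
lemma entering_flows_imp_globally_asymptotically_stable:
  assumes lip: "local_lipschitz {0::real} \<Omega> (\<lambda>_. g)"
    and global: "\<And>x\<^sub>0. x\<^sub>0 \<in> \<Omega> \<Longrightarrow> {0..} \<subseteq> existence_ivl g \<Omega> x\<^sub>0"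
    and entry: "\<And>x\<^sub>0. x\<^sub>0 \<in> \<Omega> \<Longrightarrow> \<exists>\<tau>\<ge>0. norm (flow g \<Omega> x\<^sub>0 \<tau> - p) \<le> r"
  shows "\<exists>y. equilibrium g \<Omega> y \<and> (\<forall>z. equilibrium g \<Omega> z \<longrightarrow> z = y) \<and> globally_asymptotically_stable g \<Omega> y"
proof -
  have fwd: "forward_solution g \<Omega> (flow g \<Omega> x\<^sub>0)" "flow g \<Omega> x\<^sub>0 0 = x\<^sub>0" if "x\<^sub>0 \<in> \<Omega>" for x\<^sub>0
    using flow_forward[OF \<Omega>(1) lip that global[OF that]] by auto
  have late: "\<exists>\<tau>\<ge>0. forward_solution g \<Omega> (\<lambda>t. flow g \<Omega> x\<^sub>0 (\<tau> + t)) \<and>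
      (\<forall>t\<ge>0. norm (flow g \<Omega> x\<^sub>0 (\<tau> + t) - p) \<le> \<rho>)" if "x\<^sub>0 \<in> \<Omega>" for x\<^sub>0
  proof -
    obtain \<tau> where \<tau>: "\<tau> \<ge> 0" "norm (flow g \<Omega> x\<^sub>0 \<tau> - p) \<le> r" using entry[OF \<open>x\<^sub>0 \<in> \<Omega>\<close>] by blast
    have "forward_solution g \<Omega> (\<lambda>t. flow g \<Omega> x\<^sub>0 (\<tau> + t))"
      by (rule forward_solution_shift[OF fwd(1)[OF that] \<tau>(1)])
    then show ?thesis using trapped[of "\<lambda>t. flow g \<Omega> x\<^sub>0 (\<tau> + t)"] \<tau> by auto
  qed
  have "p \<in> \<Omega>" using \<Omega>(2) rho_pos by auto
  from late[OF this] obtain q where q: "norm (q - p) \<le> \<rho>" "g q = 0"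
    using trapped_solution_converges by metis
  then have "q \<in> \<Omega>" using \<Omega>(2) by (auto simp: dist_norm norm_minus_commute)
  have const: "forward_solution g \<Omega> (\<lambda>_. z)" if "z \<in> \<Omega>" "g z = 0" for z
    using that by (auto simp: forward_solution_def)
  have lim: "(flow g \<Omega> x\<^sub>0 \<longlongrightarrow> q) at_top" if x0: "x\<^sub>0 \<in> \<Omega>" for x\<^sub>0
  proof -
    obtain \<tau> where \<tau>: "\<tau> \<ge> 0" "forward_solution g \<Omega> (\<lambda>t. flow g \<Omega> x\<^sub>0 (\<tau> + t))"
      "\<And>t. t \<ge> 0 \<Longrightarrow> norm (flow g \<Omega> x\<^sub>0 (\<tau> + t) - p) \<le> \<rho>" using late[OF x0] by blast
    let ?y = "\<lambda>t. flow g \<Omega> x\<^sub>0 (\<tau> + t)"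
    define c where "c = (\<lambda>t. M * (1 / 2) ^ nat \<lfloor>t / T\<rfloor> * norm (?y 0 - q))"
    have c0: "(c \<longlongrightarrow> 0) at_top"
      unfolding c_def by (rule tendsto_mult_left_zero[OF tendsto_mult_right_zero[OF geometric_factor_tendsto_0[OF T]]])
    have "norm (?y t - q) \<le> c t" if "t \<ge> 0" for t unfolding c_def
      by (rule trapped_solutions_contract[OF \<tau>(2,3) const[OF \<open>q \<in> \<Omega>\<close> q(2)] q(1) that])
    then have "((\<lambda>t. ?y t - q) \<longlongrightarrow> 0) at_top"
      by (intro Lim_null_comparison[OF _ c0] eventually_mono[OF eventually_ge_at_top[of 0]]) auto
    then have lim: "(?y \<longlongrightarrow> q) at_top" by (simp add: LIM_zero_iff)
    have "filterlim (\<lambda>s. s - \<tau>) at_top at_top"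
      unfolding filterlim_at_top
    proof
      fix Z
      show "eventually (\<lambda>s. Z \<le> s - \<tau>) at_top"
        using eventually_ge_at_top[of "Z + \<tau>"] by eventually_elim simp
    qed
    from filterlim_compose[OF lim this] show ?thesis by simp
  qed
  have unique: "z = q" if z: "equilibrium g \<Omega> z" for z
  proof -
    have z: "z \<in> \<Omega>" "g z = 0" using z by (auto simp: equilibrium_def)
    have "is_solution g \<Omega> z UNIV (\<lambda>_. z)" using z by (auto simp: is_solution_def)
    then have "flow g \<Omega> z t = z" if "t \<ge> 0" for t
      using solutions_unique[OF \<Omega>(1) lip flow_is_solution[OF \<Omega>(1) lip z(1)]] global[OF z(1)] that by blast
    then have "eventually (\<lambda>t. flow g \<Omega> z t = z) at_top"
      by (rule eventually_mono[OF eventually_ge_at_top[of "0::real"]])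
    then have "(flow g \<Omega> z \<longlongrightarrow> z) at_top" by (rule tendsto_eventually)
    then show ?thesis using tendsto_unique[OF trivial_limit_at_top_linorder _ lim[OF z(1)]] by blast
  qed
  have "lyapunov_stable g \<Omega> q"
    unfolding lyapunov_stable_def
  proof (intro allI impI)
    fix e :: real assume "e > 0"
    define d where "d = min (r / 2) (e / M)"
    have "d > 0" using r M \<open>e > 0\<close> by (simp add: d_def)
    moreover have "t \<in> existence_ivl g \<Omega> y\<^sub>0 \<and> norm (flow g \<Omega> y\<^sub>0 t - q) < e"
      if y: "y\<^sub>0 \<in> \<Omega>" "norm (y\<^sub>0 - q) < d" and t: "t \<ge> 0" for y\<^sub>0 t
    proof
      show "t \<in> existence_ivl g \<Omega> y\<^sub>0" using global[OF y(1)] t by auto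
      have "norm (y\<^sub>0 - p) \<le> r"
        using y(2) equilibrium_near_center[OF q(2,1)] norm_triangle_ineq[of "y\<^sub>0 - q" "q - p"] by (simp add: d_def)
      then have tr: "norm (flow g \<Omega> y\<^sub>0 t - p) \<le> \<rho>" if "t \<ge> 0" for t
        using trapped[OF fwd(1)[OF y(1)] _ that] fwd(2)[OF y(1)] by simp
      have "norm (flow g \<Omega> y\<^sub>0 t - q) \<le> M * (1 / 2) ^ nat \<lfloor>t / T\<rfloor> * norm (flow g \<Omega> y\<^sub>0 0 - q)"
        by (rule trapped_solutions_contract[OF fwd(1)[OF y(1)] tr const[OF \<open>q \<in> \<Omega>\<close> q(2)] q(1) t])
      also have "\<dots> \<le> M * 1 * norm (y\<^sub>0 - q)"
        unfolding fwd(2)[OF y(1)] using M by (intro mult_mono power_le_one) auto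
      also have "\<dots> < e" using y(2) M by (simp add: d_def field_simps)
      finally show "norm (flow g \<Omega> y\<^sub>0 t - q) < e" .
    qed
    ultimately show "\<exists>d>0. \<forall>y\<^sub>0\<in>\<Omega>. norm (y\<^sub>0 - q) < d \<longrightarrow>
        (\<forall>t\<ge>0. t \<in> existence_ivl g \<Omega> y\<^sub>0 \<and> norm (flow g \<Omega> y\<^sub>0 t - q) < e)" by blast
  qed
  then have "globally_asymptotically_stable g \<Omega> q"
    unfolding globally_asymptotically_stable_def using global lim by blast
  moreover have "equilibrium g \<Omega> q" using \<open>q \<in> \<Omega>\<close> q by (simp add: equilibrium_def)
  ultimately show ?thesis using unique by blast
qed

end

section \<open>Uniform entry from a compact set\<close>

text \<open>
  A perturbed solution that starts near \<open>x\<close> satisfies, as long as it is in the tube around \<open>x\<close>,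
  a linear differential inequality whose inhomogeneity is the distance between the vector fields
  along \<open>x\<close>. That distance is uniformly small by uniform continuity on a compact set.
\<close>
lemma continuous_dependence:
  fixes F :: "real \<Rightarrow> 'a::euclidean_space \<Rightarrow> 'a"
  assumes "open \<Omega>" and lip: "local_lipschitz I \<Omega> F" and "compact I" and "0 \<in> I"
    and cont: "\<And>x. x \<in> \<Omega> \<Longrightarrow> continuous_on I (\<lambda>e. F e x)"
    and x: "forward_solution (F 0) \<Omega> x" and "\<tau> \<ge> 0" and "r > 0"
  obtains \<delta> where "\<delta> > 0" "\<And>e z. e \<in> I \<Longrightarrow> \<bar>e\<bar> < \<delta> \<Longrightarrow> forward_solution (F e) \<Omega> z \<Longrightarrow>
    norm (z 0 - x 0) < \<delta> \<Longrightarrow> norm (z \<tau> - x \<tau>) < r"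
proof -
  define K where "K = x ` {0..\<tau>}"
  have xd: "(x has_vector_derivative F 0 (x t)) (at t)" "x t \<in> \<Omega>" if "t \<ge> 0" for t
    using x that by (auto simp: forward_solution_def)
  then have "continuous_on {0..\<tau>} x"
    by (intro continuous_at_imp_continuous_on ballI has_vector_derivative_continuous) auto
  then have "compact K" unfolding K_def by (rule compact_continuous_image) simp
  have "K \<subseteq> \<Omega>" using xd by (auto simp: K_def)
  obtain \<rho> L where tube: "\<rho> > 0" "L \<ge> 0"
    and tl: "\<And>e y w. e \<in> I \<Longrightarrow> y \<in> K \<Longrightarrow> norm w \<le> \<rho> \<Longrightarrow> norm (F e (y + w) - F e y) \<le> L * norm w"
    using uniform_tube[OF lip \<open>compact I\<close> cont \<open>open \<Omega>\<close> \<open>compact K\<close> \<open>K \<subseteq> \<Omega>\<close>] by metis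
  define c where "c = min \<rho> r"
  define \<kappa> where "\<kappa> = c * exp (- (L * \<tau>)) / (2 * (\<tau> + 1))"
  have c: "c > 0" "c \<le> \<rho>" "c \<le> r" using tube \<open>r > 0\<close> by (auto simp: c_def)
  then have "\<kappa> > 0" using \<open>\<tau> \<ge> 0\<close> by (simp add: \<kappa>_def)
  have "continuous_on (I \<times> \<Omega>) (\<lambda>(e, y). F e y)"
    by (rule continuous_on_TimesI[OF lip cont])
  then have "continuous_on (I \<times> K) (\<lambda>(e, y). F e y)"
    by (rule continuous_on_subset) (use \<open>K \<subseteq> \<Omega>\<close> in auto)
  then have "uniformly_continuous_on (I \<times> K) (\<lambda>(e, y). F e y)"
    by (intro compact_uniformly_continuous compact_Times \<open>compact I\<close> \<open>compact K\<close>)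
  then obtain d where "d > 0" and d: "\<And>p q. p \<in> I \<times> K \<Longrightarrow> q \<in> I \<times> K \<Longrightarrow> dist q p < d \<Longrightarrow>
      dist (case q of (e, y) \<Rightarrow> F e y) (case p of (e, y) \<Rightarrow> F e y) < \<kappa>"
    using \<open>\<kappa> > 0\<close> unfolding uniformly_continuous_on_def by metis
  define \<delta> where "\<delta> = min d \<kappa>"
  show thesis
  proof
    show "\<delta> > 0" using \<open>d > 0\<close> \<open>\<kappa> > 0\<close> by (simp add: \<delta>_def)
    fix e z assume e: "e \<in> I" "\<bar>e\<bar> < \<delta>" and z: "forward_solution (F e) \<Omega> z" and z0: "norm (z 0 - x 0) < \<delta>"
    have "norm (z 0 - x 0) + \<kappa> * \<tau> < \<kappa> * (1 + \<tau>)"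
      using z0 by (simp add: \<delta>_def algebra_simps)
    also have "\<kappa> * (1 + \<tau>) = c * exp (- (L * \<tau>)) / 2" using \<open>\<tau> \<ge> 0\<close> by (simp add: \<kappa>_def divide_simps)
    finally have "(norm (z 0 - x 0) + \<kappa> * \<tau>) * exp (L * \<tau>) < c * exp (- (L * \<tau>)) / 2 * exp (L * \<tau>)"
      by (intro mult_strict_right_mono) auto
    also have "\<dots> < c" using c by (simp add: exp_minus)
    finally have small: "(norm (z 0 - x 0) + \<kappa> * \<tau>) * exp (L * \<tau>) < c" .
    have "norm (z \<tau> - x \<tau>) \<le> (norm (z 0 - x 0) + \<kappa> * \<tau>) * exp (L * \<tau>)"
    proof (rule gronwall_bootstrap[where w = "\<lambda>t. z t - x t" and w' = "\<lambda>t. F e (z t) - F 0 (x t)" and T = \<tau> and \<rho> = c])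
      fix t assume t: "t \<in> {0..\<tau>}"
      show "((\<lambda>t. z t - x t) has_vector_derivative F e (z t) - F 0 (x t)) (at t)"
        using z t xd by (intro has_vector_derivative_diff) (auto simp: forward_solution_def)
      assume "norm (z t - x t) \<le> c"
      then have 1: "norm (F e (z t) - F e (x t)) \<le> L * norm (z t - x t)"
        using tl[of e "x t" "z t - x t"] e t c by (auto simp: K_def)
      have "dist (e, x t) (0, x t) < d" using e by (simp add: dist_prod_def \<delta>_def)
      then have 2: "norm (F e (x t) - F 0 (x t)) < \<kappa>"
        using d[of "(0, x t)" "(e, x t)"] e t \<open>0 \<in> I\<close> by (auto simp: K_def dist_norm)
      show "norm (F e (z t) - F 0 (x t)) \<le> L * norm (z t - x t) + \<kappa>"
        using 1 2 norm_triangle_ineq[of "F e (z t) - F e (x t)" "F e (x t) - F 0 (x t)"] by simp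
    qed (use tube \<open>\<kappa> > 0\<close> small \<open>\<tau> \<ge> 0\<close> in auto)
    then show "norm (z \<tau> - x \<tau>) < r" using small c by linarith
  qed
qed

text \<open>
  The entry time of a point of \<open>K\<close> also serves for nearby initial values and small
  parameters. Compactness of \<open>K\<close> makes the bound on the parameter uniform, while every initial value
  keeps an entry time of its own.
\<close>
lemma uniform_entry:
  fixes F :: "real \<Rightarrow> 'a::euclidean_space \<Rightarrow> 'a"
  assumes "open \<Omega>" and lip: "local_lipschitz I \<Omega> F" and "compact I" and "0 \<in> I"
    and cont: "\<And>x. x \<in> \<Omega> \<Longrightarrow> continuous_on I (\<lambda>e. F e x)"
    and "compact K" and "r > 0"
    and attr: "\<And>y. y \<in> K \<Longrightarrow> \<exists>x. forward_solution (F 0) \<Omega> x \<and> x 0 = y \<and> (x \<longlongrightarrow> p) at_top"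
  obtains \<delta> where "\<delta> > 0" "\<And>e z. e \<in> I \<Longrightarrow> \<bar>e\<bar> < \<delta> \<Longrightarrow> forward_solution (F e) \<Omega> z \<Longrightarrow> z 0 \<in> K \<Longrightarrow>
    \<exists>\<tau>\<ge>0. norm (z \<tau> - p) \<le> r"
proof -
  have "\<exists>\<delta>>0. \<forall>e z. e \<in> I \<longrightarrow> \<bar>e\<bar> < \<delta> \<longrightarrow> forward_solution (F e) \<Omega> z \<longrightarrow> z 0 \<in> ball y \<delta> \<longrightarrow>
      (\<exists>\<tau>\<ge>0. norm (z \<tau> - p) \<le> r)" if y: "y \<in> K" for y
  proof -
    obtain x where x: "forward_solution (F 0) \<Omega> x" "x 0 = y" "(x \<longlongrightarrow> p) at_top"
      using attr[OF y] by blast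
    have "eventually (\<lambda>t. dist (x t) p < r / 2) at_top" using x(3) \<open>r > 0\<close> by (intro tendstoD) auto
    then obtain t0 where t0: "\<And>t. t \<ge> t0 \<Longrightarrow> dist (x t) p < r / 2"
      unfolding eventually_at_top_linorder by blast
    define \<tau> where "\<tau> = max 0 t0"
    have \<tau>: "\<tau> \<ge> 0" "norm (x \<tau> - p) < r / 2" using t0[of \<tau>] by (auto simp: \<tau>_def dist_norm)
    have "r / 2 > 0" using \<open>r > 0\<close> by simp
    then obtain \<delta> where \<delta>: "\<delta> > 0" "\<And>e z. e \<in> I \<Longrightarrow> \<bar>e\<bar> < \<delta> \<Longrightarrow> forward_solution (F e) \<Omega> z \<Longrightarrow>
        norm (z 0 - x 0) < \<delta> \<Longrightarrow> norm (z \<tau> - x \<tau>) < r / 2"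
      using continuous_dependence[OF \<open>open \<Omega>\<close> lip \<open>compact I\<close> \<open>0 \<in> I\<close> cont x(1) \<tau>(1)] by metis
    show ?thesis
    proof (rule exI[of _ \<delta>], intro conjI allI impI)
      fix e z assume e: "e \<in> I" "\<bar>e\<bar> < \<delta>" and z: "forward_solution (F e) \<Omega> z" "z 0 \<in> ball y \<delta>"
      then have "norm (z \<tau> - x \<tau>) < r / 2"
        using x(2) by (intro \<delta>(2)) (auto simp: dist_norm norm_minus_commute)
      then have "norm (z \<tau> - p) \<le> r"
        using \<tau>(2) norm_triangle_ineq[of "z \<tau> - x \<tau>" "x \<tau> - p"] by simp
      then show "\<exists>\<tau>\<ge>0. norm (z \<tau> - p) \<le> r" using \<tau>(1) by blast
    qed (rule \<delta>(1))
  qed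
  then obtain \<delta> where \<delta>: "\<And>y. y \<in> K \<Longrightarrow> \<delta> y > 0"
    "\<And>y e z. y \<in> K \<Longrightarrow> e \<in> I \<Longrightarrow> \<bar>e\<bar> < \<delta> y \<Longrightarrow> forward_solution (F e) \<Omega> z \<Longrightarrow> z 0 \<in> ball y (\<delta> y) \<Longrightarrow>
      \<exists>\<tau>\<ge>0. norm (z \<tau> - p) \<le> r"
    by metis
  have "K \<subseteq> (\<Union>y\<in>K. ball y (\<delta> y))" using \<delta>(1) by force
  then obtain C where C: "C \<subseteq> K" "finite C" "K \<subseteq> (\<Union>y\<in>C. ball y (\<delta> y))"
    using compactE_image[OF \<open>compact K\<close>, of K "\<lambda>y. ball y (\<delta> y)"] by blast
  define \<delta>m where "\<delta>m = Min (insert 1 (\<delta> ` C))"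
  show thesis
  proof
    show "\<delta>m > 0" unfolding \<delta>m_def using C \<delta>(1) by (subst Min_gr_iff) auto
    fix e z assume e: "e \<in> I" "\<bar>e\<bar> < \<delta>m" and z: "forward_solution (F e) \<Omega> z" "z 0 \<in> K"
    then obtain y where y: "y \<in> C" "z 0 \<in> ball y (\<delta> y)" using C by blast
    then have "\<delta>m \<le> \<delta> y" unfolding \<delta>m_def using C by (intro Min_le) auto
    then show "\<exists>\<tau>\<ge>0. norm (z \<tau> - p) \<le> r" using \<delta>(2)[of y e z] e z y C by auto
  qed
qed

section \<open>Persistence of global asymptotic stability\<close>

theorem mainTheorem1:
  fixes \<Omega> :: "(real ^ 'n) set"
    and \<epsilon>\<^sub>0 :: real
    and f :: "real ^ 'n \<Rightarrow> real \<Rightarrow> real ^ 'n"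
    and x\<^sub>s :: "real ^ 'n"
  assumes "open \<Omega>"
    and "\<epsilon>\<^sub>0 > 0"
    and "C1_in_state f \<Omega> \<epsilon>\<^sub>0"
    and "continuous_in_parameter f \<Omega> \<epsilon>\<^sub>0"
    and "uniformly_dissipative f \<Omega> \<epsilon>\<^sub>0"
    and "equilibrium (\<lambda>x. f x 0) \<Omega> x\<^sub>s"
    and "globally_asymptotically_stable (\<lambda>x. f x 0) \<Omega> x\<^sub>s"
    and "locally_exponentially_stable (\<lambda>x. f x 0) \<Omega> x\<^sub>s"
  shows "\<exists>\<epsilon>\<^sub>s. 0 < \<epsilon>\<^sub>s \<and> \<epsilon>\<^sub>s \<le> \<epsilon>\<^sub>0 \<and>
           (\<forall>\<epsilon>\<in>{-\<epsilon>\<^sub>s..\<epsilon>\<^sub>s}. \<exists>y.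
              equilibrium (\<lambda>x. f x \<epsilon>) \<Omega> y \<and>
              (\<forall>z. equilibrium (\<lambda>x. f x \<epsilon>) \<Omega> z \<longrightarrow> z = y) \<and>
              globally_asymptotically_stable (\<lambda>x. f x \<epsilon>) \<Omega> y)"
proof -
  define I where "I = {-\<epsilon>\<^sub>0..\<epsilon>\<^sub>0}"
  have I: "compact I" "0 \<in> I" using \<open>\<epsilon>\<^sub>0 > 0\<close> by (auto simp: I_def)
  have lip: "local_lipschitz I \<Omega> (\<lambda>e x. f x e)"
    unfolding I_def by (rule C1_local_lipschitz[OF \<open>open \<Omega>\<close> \<open>C1_in_state f \<Omega> \<epsilon>\<^sub>0\<close>])
  have lip1: "local_lipschitz {0::real} \<Omega> (\<lambda>_ x. f x e)" if "e \<in> I" for e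
    using local_lipschitz_compose1[where f = "\<lambda>e x. f x e" and g = "\<lambda>_::real. e" and T = "{0}" and X = \<Omega>]
      local_lipschitz_subset[OF lip, of "{e}" \<Omega>] that by auto
  have par: "continuous_on I (\<lambda>e. f x e)" if "x \<in> \<Omega>" for x
    using \<open>continuous_in_parameter f \<Omega> \<epsilon>\<^sub>0\<close> that by (simp add: continuous_in_parameter_def I_def)
  have contx: "continuous_on \<Omega> (\<lambda>x. f x e)" if "e \<in> I" for e
    by (rule local_lipschitz_continuous_on[OF lip that])
  have p: "x\<^sub>s \<in> \<Omega>" "f x\<^sub>s 0 = 0" using assms(6) by (auto simp: equilibrium_def)
  obtain A where A: "((\<lambda>x. f x 0) has_derivative A) (at x\<^sub>s)"
    and near: "\<And>\<eta>. \<eta> > 0 \<Longrightarrow> \<exists>\<rho>>0. cball x\<^sub>s \<rho> \<subseteq> \<Omega> \<and> (\<exists>\<delta>>0. \<forall>e\<in>I. \<bar>e\<bar> < \<delta> \<longrightarrow>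
        (\<forall>x\<in>cball x\<^sub>s \<rho>. \<forall>y\<in>cball x\<^sub>s \<rho>. norm (f x e - f y e - A (x - y)) \<le> \<eta> * norm (x - y)))"
    using C1_near_linear[OF \<open>open \<Omega>\<close> p(1) \<open>\<epsilon>\<^sub>0 > 0\<close> \<open>C1_in_state f \<Omega> \<epsilon>\<^sub>0\<close>] unfolding I_def by blast
  obtain T \<eta> M where c: "T > 0" "\<eta> > 0" "M > 0" "contracts A \<eta> T M"
    using exponential_stability_contracts[OF \<open>open \<Omega>\<close> lip1[OF I(2)] p A assms(8)] by blast
  obtain \<rho> \<delta>1 where \<rho>: "\<rho> > 0" "cball x\<^sub>s \<rho> \<subseteq> \<Omega>" and "\<delta>1 > 0"
    and \<delta>1: "\<And>e x y. e \<in> I \<Longrightarrow> \<bar>e\<bar> < \<delta>1 \<Longrightarrow> x \<in> cball x\<^sub>s \<rho> \<Longrightarrow> y \<in> cball x\<^sub>s \<rho> \<Longrightarrow>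
      norm (f x e - f y e - A (x - y)) \<le> \<eta> * norm (x - y)"
    using near[OF c(2)] by blast
  \<comment> \<open>The radius \<open>r\<close> leaves room for the growth factor \<open>M\<close> inside \<open>\<rho>\<close>, and \<open>\<kappa>\<close> is the residual at \<open>x\<^sub>s\<close>
    that the contraction on the ball of radius \<open>r\<close> absorbs.\<close>
  define r where "r = \<rho> / (4 * M)"
  define \<kappa> where "\<kappa> = min r (r / (4 * M))"
  have r: "r > 0" "M * r = \<rho> / 4" using \<rho> c by (auto simp: r_def)
  have \<kappa>: "\<kappa> > 0" using r c by (simp add: \<kappa>_def)
  have small: "M * (r + \<kappa>) < \<rho>" "4 * M * \<kappa> \<le> r"
  proof -
    have "M * \<kappa> \<le> M * r" using c by (intro mult_left_mono) (auto simp: \<kappa>_def)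
    then have "M * (r + \<kappa>) \<le> \<rho> / 2" using r by (simp add: distrib_left)
    then show "M * (r + \<kappa>) < \<rho>" using \<rho> by linarith
    have "(4 * M) * \<kappa> \<le> (4 * M) * (r / (4 * M))" using c by (intro mult_left_mono) (auto simp: \<kappa>_def)
    then show "4 * M * \<kappa> \<le> r" using c by simp
  qed
  obtain \<delta>2 where "\<delta>2 > 0" and \<delta>2: "\<And>e. e \<in> I \<Longrightarrow> \<bar>e\<bar> < \<delta>2 \<Longrightarrow> norm (f x\<^sub>s e) \<le> \<kappa>"
    using par[OF p(1), unfolded continuous_on_iff, rule_format, OF I(2) \<kappa>] p(2)
    by (auto simp: dist_norm less_imp_le)
  obtain K where K: "compact K" "K \<subseteq> \<Omega>" "\<And>e. e \<in> I \<Longrightarrow> absorbing (\<lambda>x. f x e) \<Omega> K"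
    using assms(5) unfolding uniformly_dissipative_def I_def by blast
  have attr: "\<exists>x. forward_solution (\<lambda>x. f x 0) \<Omega> x \<and> x 0 = y \<and> (x \<longlongrightarrow> x\<^sub>s) at_top" if "y \<in> K" for y
  proof -
    have "y \<in> \<Omega>" using that K by auto
    then have "{0..} \<subseteq> existence_ivl (\<lambda>x. f x 0) \<Omega> y" "(flow (\<lambda>x. f x 0) \<Omega> y \<longlongrightarrow> x\<^sub>s) at_top"
      using assms(7) unfolding globally_asymptotically_stable_def by auto
    then show ?thesis using flow_forward[OF \<open>open \<Omega>\<close> lip1[OF I(2)] \<open>y \<in> \<Omega>\<close>] by blast
  qed
  obtain \<delta>3 where "\<delta>3 > 0" and \<delta>3: "\<And>e z. e \<in> I \<Longrightarrow> \<bar>e\<bar> < \<delta>3 \<Longrightarrow> forward_solution (\<lambda>x. f x e) \<Omega> z \<Longrightarrow>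
      z 0 \<in> K \<Longrightarrow> \<exists>\<tau>\<ge>0. norm (z \<tau> - x\<^sub>s) \<le> r"
    using uniform_entry[OF \<open>open \<Omega>\<close> lip I par K(1) r(1) attr] by blast
  define \<epsilon>\<^sub>s where "\<epsilon>\<^sub>s = min \<epsilon>\<^sub>0 (min \<delta>1 (min \<delta>2 \<delta>3) / 2)"
  have "0 < \<epsilon>\<^sub>s" "\<epsilon>\<^sub>s \<le> \<epsilon>\<^sub>0" "\<epsilon>\<^sub>s < \<delta>1" "\<epsilon>\<^sub>s < \<delta>2" "\<epsilon>\<^sub>s < \<delta>3"
    using \<open>\<epsilon>\<^sub>0 > 0\<close> \<open>\<delta>1 > 0\<close> \<open>\<delta>2 > 0\<close> \<open>\<delta>3 > 0\<close> by (auto simp: \<epsilon>\<^sub>s_def)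
  moreover have "\<exists>y. equilibrium (\<lambda>x. f x \<epsilon>) \<Omega> y \<and> (\<forall>z. equilibrium (\<lambda>x. f x \<epsilon>) \<Omega> z \<longrightarrow> z = y) \<and>
      globally_asymptotically_stable (\<lambda>x. f x \<epsilon>) \<Omega> y" if \<epsilon>: "\<epsilon> \<in> I" "\<bar>\<epsilon>\<bar> < \<delta>1" "\<bar>\<epsilon>\<bar> < \<delta>2" "\<bar>\<epsilon>\<bar> < \<delta>3" for \<epsilon>
  proof -
    interpret trapping_ball "\<lambda>x. f x \<epsilon>" \<Omega> x\<^sub>s A \<eta> T M \<rho> r \<kappa>
      by unfold_locales (use c \<kappa> \<open>open \<Omega>\<close> \<rho> contx \<delta>1 \<delta>2 r small \<epsilon> in auto)
    show ?thesis
    proof (rule entering_flows_imp_globally_asymptotically_stable[OF lip1[OF \<epsilon>(1)]])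
      fix x\<^sub>0 assume x0: "x\<^sub>0 \<in> \<Omega>"
      note absorbed = absorbing_flow[OF \<open>open \<Omega>\<close> lip1[OF \<epsilon>(1)] x0 K(3)[OF \<epsilon>(1)]]
      show "{0..} \<subseteq> existence_ivl (\<lambda>x. f x \<epsilon>) \<Omega> x\<^sub>0" by (rule absorbed(1))
      then have fwd: "forward_solution (\<lambda>x. f x \<epsilon>) \<Omega> (flow (\<lambda>x. f x \<epsilon>) \<Omega> x\<^sub>0)"
        by (rule flow_forward[OF \<open>open \<Omega>\<close> lip1[OF \<epsilon>(1)] x0])
      obtain t where t: "t \<ge> 0" "flow (\<lambda>x. f x \<epsilon>) \<Omega> x\<^sub>0 t \<in> K" using absorbed(2) by blast
      obtain \<tau> where "\<tau> \<ge> 0" "norm (flow (\<lambda>x. f x \<epsilon>) \<Omega> x\<^sub>0 (t + \<tau>) - x\<^sub>s) \<le> r"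
        using \<delta>3[OF \<epsilon>(1,4) forward_solution_shift[OF fwd t(1)]] t(2) by auto
      then show "\<exists>\<tau>\<ge>0. norm (flow (\<lambda>x. f x \<epsilon>) \<Omega> x\<^sub>0 \<tau> - x\<^sub>s) \<le> r"
        using t(1) by (intro exI[of _ "t + \<tau>"]) simp
    qed
  qed
  ultimately show ?thesis by (intro exI[of _ \<epsilon>\<^sub>s]) (auto simp: I_def)
qed

end
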